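(* Let $(\mathfrak g,\pi)$ and $(\mathfrak h,\mu)$ be finite-dimensional real $3$-Lie algebras and let $f:\mathfrak g\to\mathfrak h$ be a $3$-Lie algebra morphism. If $H^2(f)=0$, then in a neighborhood of $f$ in $\mathrm{Hom}(\mathfrak g,\mathfrak h)$ the space of $3$-Lie algebra morphisms from $\mathfrak g$ to $\mathfrak h$ is a smooth (sub)manifold of dimension $\dim Z^1(f)$, and any $\alpha\in Z^1(f)$ gives rise to a deformation of $f$, i.e. there is a deformation $f_t$ of $f$ with $\frac{d}{dt}\big|_{t=0}f_t=\alpha$.
   Context: A $3$-Lie algebra is a vector space $\mathfrak g$ with a linear map $\pi:\wedge^3\mathfrak g\to\mathfrak g$ such that $\pi(x_1,x_2,\pi(x_3,x_4,x_5))=\pi(\pi(x_1,x_2,x_3),x_4,x_5)+\pi(x_3,\pi(x_1,x_2,x_4),x_5)+\pi(x_3,x_4,\pi(x_1,x_2,x_5))$ for all $x_i\in\mathfrak g$. A $3$-Lie algebra morphism $(\mathfrak g,\pi)\to(\mathfrak h,\mu)$ is a linear map $f$ with $f(\pi(x,y,z))=\mu(f(x),f(y),f(z))$. A deformation of a $3$-Lie algebra morphism $f$ from $(\mathfrak g,\pi)$ to $(\mathfrak h,\mu)$ is a smooth one-parameter family $f_t$ ($t$ in an open interval containing $0$) of $3$-Lie algebra morphisms from $(\mathfrak g,\pi)$ to $(\mathfrak h,\mu)$ with $f_0=f$. Cohomology of $f$: $C^1(f)=\mathrm{Hom}(\mathfrak g,\mathfrak h)$, $C^2(f)=\mathrm{Hom}(\wedge^3\mathfrak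 g,\mathfrak h)$, $C^3(f)=\mathrm{Hom}(\wedge^2\mathfrak g\otimes\wedge^3\mathfrak g,\mathfrak h)$ (the last space is written $\mathrm{Hom}(\wedge^2\mathfrak g\otimes\wedge^2\mathfrak g\wedge\mathfrak g,\mathfrak h)$). For $\theta\in C^n(f)$, $n\ge1$, $\mathfrak X_i=x_i\wedge y_i\in\wedge^2\mathfrak g$, $x\in\mathfrak g$, with $\pi(\mathfrak X_i,z)=\pi(x_i,y_i,z)$, $$\begin{aligned}\delta(\theta)(\mathfrak X_1,\dots,\mathfrak X_n,x)=&\sum_{1\le i<j\le n}(-1)^i\theta\big(\mathfrak X_1,\dots,\widehat{\mathfrak X_i},\dots,\mathfrak X_{j-1},\pi(\mathfrak X_i,x_j)\wedge y_j+x_j\wedge\pi(\mathfrak X_i,y_j),\dots,\mathfrak X_n,x\big)\\&+\sum_{i=1}^n(-1)^i\theta(\mathfrak X_1,\dots,\widehat{\mathfrak X_i},\dots,\mathfrak X_n,\pi(\mathfrak X_i,x))\\&+\sum_{i=1}^n(-1)^{i+1}\mu\big(f(x_i),f(y_i),\theta(\mathfrak X_1,\dots,\widehat{\mathfrak X_i},\dots,\mathfrak X_n,x)\big)\\&+(-1)^{n-1}\Big(\mu(\theta(\mathfrak X_1,\dots,\mathfrak X_{n-1},x_n),f(y_n),f(x))+\mu(f(x_n),\theta(\mathfrak X_1,\dots,\mathfrak X_{n-1},y_n),f(x))\Big).\end{aligned}$$ In particular for $n=1$: $\delta(\theta)(x\wedge y,z)=-\theta(\pi(x,y,z))+\mu(f(x),f(y),\theta(z))+\mu(\theta(x),f(y),f(z))+\mu(f(x),\theta(y),f(z))$.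 $Z^n(f)=\ker(\delta|_{C^n(f)})$ and $H^2(f)=Z^2(f)/\delta(C^1(f))$. *)

theory Defs
  imports "HOL-Analysis.Analysis"
begin

text \<open>
  Throughout, \<open>\<gg>\<close> and \<open>\<hh>\<close> are types \<open>'a\<close> and \<open>'b\<close> of class \<^class>\<open>real_normed_vector\<close>, and
  the main theorem assumes that both are finite-dimensional (dimension zero included).
  The norm only serves to provide the canonical topology of a finite-dimensional real vector space;
  no definition below depends on its choice.  Since every linear map between
  finite-dimensional spaces is bounded, \<open>Hom(\<gg>,\<hh>)\<close> is the normed space \<open>'a \<Rightarrow>\<^sub>L 'b\<close>.
\<close>

section \<open>3-Lie algebras and their morphisms\<close>

text \<open>Linear maps on the third exterior power, as alternating trilinear maps.\<close>

definition alternating3 :: "('a::real_vector \<Rightarrow> 'a \<Rightarrow> 'a \<Rightarrow> 'b::real_vector) \<Rightarrow> bool" where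
  "alternating3 \<theta> \<longleftrightarrow>
     (\<forall>y z. linear (\<lambda>x. \<theta> x y z)) \<and>
     (\<forall>x z. linear (\<lambda>y. \<theta> x y z)) \<and>
     (\<forall>x y. linear (\<lambda>z. \<theta> x y z)) \<and>
     (\<forall>x y. \<theta> x x y = 0 \<and> \<theta> x y x = 0 \<and> \<theta> y x x = 0)"

definition three_lie_algebra :: "('a::real_vector \<Rightarrow> 'a \<Rightarrow> 'a \<Rightarrow> 'a) \<Rightarrow> bool" where
  "three_lie_algebra \<pi> \<longleftrightarrow> alternating3 \<pi> \<and>
     (\<forall>x1 x2 x3 x4 x5.
        \<pi> x1 x2 (\<pi> x3 x4 x5) =
          \<pi> (\<pi> x1 x2 x3) x4 x5 + \<pi> x3 (\<pi> x1 x2 x4) x5 + \<pi> x3 x4 (\<pi> x1 x2 x5))"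

text \<open>Linearity of \<open>f\<close> is part of its type.\<close>

definition three_lie_morphism ::
  "('a::real_normed_vector \<Rightarrow> 'a \<Rightarrow> 'a \<Rightarrow> 'a) \<Rightarrow> ('b::real_normed_vector \<Rightarrow> 'b \<Rightarrow> 'b \<Rightarrow> 'b) \<Rightarrow>
   ('a \<Rightarrow>\<^sub>L 'b) \<Rightarrow> bool" where
  "three_lie_morphism \<pi> \<mu> f \<longleftrightarrow> (\<forall>x y z. f (\<pi> x y z) = \<mu> (f x) (f y) (f z))"

section \<open>Cohomology of a morphism in degrees 1 and 2\<close>

definition coboundary1 ::
  "('a::real_normed_vector \<Rightarrow> 'a \<Rightarrow> 'a \<Rightarrow> 'a) \<Rightarrow> ('b::real_normed_vector \<Rightarrow> 'b \<Rightarrow> 'b \<Rightarrow> 'b) \<Rightarrow>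
   ('a \<Rightarrow>\<^sub>L 'b) \<Rightarrow> ('a \<Rightarrow>\<^sub>L 'b) \<Rightarrow> 'a \<Rightarrow> 'a \<Rightarrow> 'a \<Rightarrow> 'b" where
  "coboundary1 \<pi> \<mu> f \<theta> x y z =
     - \<theta> (\<pi> x y z) + \<mu> (f x) (f y) (\<theta> z) + \<mu> (\<theta> x) (f y) (f z) + \<mu> (f x) (\<theta> y) (f z)"

text \<open>
  The value at \<open>\<XX>\<^sub>1 = x1 \<and> y1\<close>, \<open>\<XX>\<^sub>2 = x2 \<and> y2\<close>, \<open>x\<close> of the general coboundary formula for \<open>n = 2\<close>.
  The lines are, in order: the sum over \<open>i < j\<close> (only \<open>(i,j) = (1,2)\<close>), the sum of the terms
  containing \<open>\<pi>(\<XX>\<^sub>i,x)\<close>, the sum of the terms containing \<open>\<mu>(f x\<^sub>i, f y\<^sub>i, -)\<close>, and the final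
  bracket with sign \<open>(-1)\<^sup>n\<^sup>-\<^sup>1 = -1\<close>.
\<close>

definition coboundary2 ::
  "('a::real_normed_vector \<Rightarrow> 'a \<Rightarrow> 'a \<Rightarrow> 'a) \<Rightarrow> ('b::real_normed_vector \<Rightarrow> 'b \<Rightarrow> 'b \<Rightarrow> 'b) \<Rightarrow>
   ('a \<Rightarrow>\<^sub>L 'b) \<Rightarrow> ('a \<Rightarrow> 'a \<Rightarrow> 'a \<Rightarrow> 'b) \<Rightarrow> 'a \<Rightarrow> 'a \<Rightarrow> 'a \<Rightarrow> 'a \<Rightarrow> 'a \<Rightarrow> 'b" where
  "coboundary2 \<pi> \<mu> f \<theta> x1 y1 x2 y2 x =
     - (\<theta> (\<pi> x1 y1 x2) y2 x + \<theta> x2 (\<pi> x1 y1 y2) x)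
     + (- \<theta> x2 y2 (\<pi> x1 y1 x) + \<theta> x1 y1 (\<pi> x2 y2 x))
     + (\<mu> (f x1) (f y1) (\<theta> x2 y2 x) - \<mu> (f x2) (f y2) (\<theta> x1 y1 x))
     - (\<mu> (\<theta> x1 y1 x2) (f y2) (f x) + \<mu> (f x2) (\<theta> x1 y1 y2) (f x))"

definition Z1 ::
  "('a::real_normed_vector \<Rightarrow> 'a \<Rightarrow> 'a \<Rightarrow> 'a) \<Rightarrow> ('b::real_normed_vector \<Rightarrow> 'b \<Rightarrow> 'b \<Rightarrow> 'b) \<Rightarrow>
   ('a \<Rightarrow>\<^sub>L 'b) \<Rightarrow> ('a \<Rightarrow>\<^sub>L 'b) set" where
  "Z1 \<pi> \<mu> f = {\<theta>. \<forall>x y z. coboundary1 \<pi> \<mu> f \<theta> x y z = 0}"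

definition Z2 ::
  "('a::real_normed_vector \<Rightarrow> 'a \<Rightarrow> 'a \<Rightarrow> 'a) \<Rightarrow> ('b::real_normed_vector \<Rightarrow> 'b \<Rightarrow> 'b \<Rightarrow> 'b) \<Rightarrow>
   ('a \<Rightarrow>\<^sub>L 'b) \<Rightarrow> ('a \<Rightarrow> 'a \<Rightarrow> 'a \<Rightarrow> 'b) set" where
  "Z2 \<pi> \<mu> f = {\<theta>. alternating3 \<theta> \<and>
     (\<forall>x1 y1 x2 y2 x. coboundary2 \<pi> \<mu> f \<theta> x1 y1 x2 y2 x = 0)}"

definition B2 ::
  "('a::real_normed_vector \<Rightarrow> 'a \<Rightarrow> 'a \<Rightarrow> 'a) \<Rightarrow> ('b::real_normed_vector \<Rightarrow> 'b \<Rightarrow> 'b \<Rightarrow> 'b) \<Rightarrow>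
   ('a \<Rightarrow>\<^sub>L 'b) \<Rightarrow> ('a \<Rightarrow> 'a \<Rightarrow> 'a \<Rightarrow> 'b) set" where
  "B2 \<pi> \<mu> f = range (coboundary1 \<pi> \<mu> f)"

text \<open>The quotient \<open>Z\<^sup>2(f) / \<delta>(C\<^sup>1(f))\<close> as a set of cosets; its zero element is the coset \<open>B2 \<pi> \<mu> f\<close>.\<close>

definition H2 ::
  "('a::real_normed_vector \<Rightarrow> 'a \<Rightarrow> 'a \<Rightarrow> 'a) \<Rightarrow> ('b::real_normed_vector \<Rightarrow> 'b \<Rightarrow> 'b \<Rightarrow> 'b) \<Rightarrow>
   ('a \<Rightarrow>\<^sub>L 'b) \<Rightarrow> ('a \<Rightarrow> 'a \<Rightarrow> 'a \<Rightarrow> 'b) set set" where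
  "H2 \<pi> \<mu> f = Z2 \<pi> \<mu> f //
     {(\<theta>, \<theta>'). \<theta> \<in> Z2 \<pi> \<mu> f \<and> \<theta>' \<in> Z2 \<pi> \<mu> f \<and> (\<lambda>x y z. \<theta>' x y z - \<theta> x y z) \<in> B2 \<pi> \<mu> f}"

section \<open>Smooth maps, submanifolds and deformations\<close>

text \<open>
  \<open>C\<^sup>k\<close> maps on an open set \<open>S\<close>.  On a finite-dimensional domain, continuity of the total derivative as a
  map into the space of linear maps is continuity of all directional derivatives, so
  this is the usual notion.
\<close>

primrec Ck_on :: "nat \<Rightarrow> 'c::real_normed_vector set \<Rightarrow> ('c \<Rightarrow> 'd::real_normed_vector) \<Rightarrow> bool" where
  "Ck_on 0 S g \<longleftrightarrow> continuous_on S g"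
| "Ck_on (Suc k) S g \<longleftrightarrow>
     (\<forall>x\<in>S. g differentiable (at x)) \<and> (\<forall>v. Ck_on k S (\<lambda>x. frechet_derivative g (at x) v))"

definition smooth_on :: "'c::real_normed_vector set \<Rightarrow> ('c \<Rightarrow> 'd::real_normed_vector) \<Rightarrow> bool" where
  "smooth_on S g \<longleftrightarrow> (\<forall>k. Ck_on k S g)"

definition diffeomorphism ::
  "'c::real_normed_vector set \<Rightarrow> 'd::real_normed_vector set \<Rightarrow> ('c \<Rightarrow> 'd) \<Rightarrow> ('d \<Rightarrow> 'c) \<Rightarrow> bool" where
  "diffeomorphism U V \<phi> \<psi> \<longleftrightarrow>
     open U \<and> open V \<and> homeomorphism U V \<phi> \<psi> \<and> smooth_on U \<phi> \<and> smooth_on V \<psi>"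

text \<open>
  Embedded submanifolds of a finite-dimensional vector space, by slice charts.  Charts take
  values in the ambient space itself instead of \<open>\<real>\<^sup>n\<close>, with a \<open>d\<close>-dimensional subspace \<open>L\<close> in place
  of \<open>\<real>\<^sup>d \<times> {0}\<close>.
\<close>

definition smooth_submanifold :: "'c::real_normed_vector set \<Rightarrow> nat \<Rightarrow> bool" where
  "smooth_submanifold M d \<longleftrightarrow>
     (\<forall>p\<in>M. \<exists>U V \<phi> \<psi> L. p \<in> U \<and> diffeomorphism U V \<phi> \<psi> \<and>
        subspace (L :: 'c set) \<and> dim L = d \<and> \<phi> ` (M \<inter> U) = L \<inter> V)"

definition deformation ::
  "('a::real_normed_vector \<Rightarrow> 'a \<Rightarrow> 'a \<Rightarrow> 'a) \<Rightarrow> ('b::real_normed_vector \<Rightarrow> 'b \<Rightarrow> 'b \<Rightarrow> 'b) \<Rightarrow>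
   ('a \<Rightarrow>\<^sub>L 'b) \<Rightarrow> real set \<Rightarrow> (real \<Rightarrow> 'a \<Rightarrow>\<^sub>L 'b) \<Rightarrow> bool" where
  "deformation \<pi> \<mu> f I F \<longleftrightarrow>
     open I \<and> is_interval I \<and> 0 \<in> I \<and> smooth_on I F \<and>
     (\<forall>t\<in>I. three_lie_morphism \<pi> \<mu> (F t)) \<and> F 0 = f"

end

theory Submission
  imports Defs
begin

text \<open>
  Write \<open>\<Phi>(g) = \<mu>(g, g, g) - g \<circ> \<pi>\<close>, so that the morphisms are the zeros of \<open>\<Phi>\<close>, and let \<open>\<Delta>\<close> be its
  derivative at \<open>f\<close>, the coboundary on \<open>C\<^sup>1(f)\<close>.  With a linear \<open>T\<close> satisfying \<open>\<Delta> T \<Delta> = \<Delta>\<close>, the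
  polynomial map \<open>\<phi>(g) = (g - f) - T \<Delta> (g - f) + T \<Phi>(g)\<close> has derivative the identity at \<open>f\<close>, hence
  is a local diffeomorphism, and \<open>\<Delta> \<phi>(g) = \<Delta> T \<Phi>(g)\<close>.  Thus \<open>\<phi>\<close> maps morphisms into \<open>Z\<^sup>1(f)\<close>.
  Conversely, let \<open>\<Delta> T \<Phi>(g) = 0\<close>.  For every linear \<open>g\<close> the cochain \<open>\<Phi>(g)\<close> is killed by the
  degree-two coboundary formed with \<open>g\<close> in place of \<open>f\<close>.  Since \<open>H\<^sup>2(f) = 0\<close>, no nonzero cochain is
  killed both by \<open>\<Delta> T\<close> and by the coboundary of \<open>f\<close>; by compactness of the unit sphere of
  \<open>C\<^sup>2(f)\<close> this persists for \<open>g\<close> near \<open>f\<close>, so \<open>\<Phi>(g) = 0\<close>.  Therefore \<open>\<phi>\<close> is a slice chart, and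
  \<open>t \<mapsto> \<phi>\<^sup>-\<^sup>1(t \<alpha>)\<close> is the deformation in the direction \<open>\<alpha>\<close>.
\<close>

section \<open>Finite-dimensional normed spaces\<close>

text \<open>A hypothesis on the type itself: dimension zero is included, and the property passes to
  operator spaces such as \<open>'c \<Rightarrow>\<^sub>L 'd\<close>, where the later arguments take
  place.\<close>

definition finite_dim :: "'c::real_vector itself \<Rightarrow> bool" where
  "finite_dim _ \<longleftrightarrow> (\<exists>B::'c set. finite B \<and> span B = UNIV)"

text \<open>A ball of radius d about b misses the closed subspace; dividing by c compares
  \<open>(-1 / c) *\<^sub>R v\<close> with b. The result controls the coefficient of b by the norm
  of the vector, which yields both closedness of spans and continuity of coordinates.\<close>

lemma insert_span_bound:
  fixes b :: "'c::real_normed_vector"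
  assumes "closed (span B)" "b \<notin> span B"
  shows "\<exists>d>0. \<forall>c. \<forall>v\<in>span B. \<bar>c\<bar> * d \<le> norm (c *\<^sub>R b + v)"
proof -
  have "open (- span B)" "b \<in> - span B" using assms by auto
  then obtain d where d: "d > 0" "ball b d \<subseteq> - span B" by (meson open_contains_ball)
  have "\<bar>c\<bar> * d \<le> norm (c *\<^sub>R b + v)" if v: "v \<in> span B" for c v
  proof (cases "c = 0")
    case False
    have "(-1 / c) *\<^sub>R v \<in> span B" using v by (rule span_scale)
    then have "(-1 / c) *\<^sub>R v \<notin> ball b d" using d by blast
    then have "d \<le> norm (b - (-1 / c) *\<^sub>R v)" by (simp add: dist_norm)
    then have "\<bar>c\<bar> * d \<le> norm (c *\<^sub>R (b - (-1 / c) *\<^sub>R v))"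
      by (simp add: mult_left_mono)
    also have "c *\<^sub>R (b - (-1 / c) *\<^sub>R v) = c *\<^sub>R b + v"
      using False by (simp add: algebra_simps)
    finally show ?thesis .
  qed simp
  with d(1) show ?thesis by blast
qed

text \<open>Induction on B: by the preceding bound, the coefficients of the new vector along a
  convergent sequence are Cauchy, so the remainders converge as well, inside the closed span of the
  old vectors.\<close>

lemma closed_span_finite:
  fixes B :: "'c::real_normed_vector set"
  assumes "finite B"
  shows "closed (span B)"
  using assms
proof induction
  case (insert b B)
  show ?case
  proof (cases "b \<in> span B")
    case True
    then show ?thesis using insert by (simp add: span_redundant)
  next
    case False
    obtain d where d: "d > 0" "\<And>c v. v \<in> span B \<Longrightarrow> \<bar>c\<bar> * d \<le> norm (c *\<^sub>R b + v)"
      using insert_span_bound[OF insert.IH False] by blast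
    show ?thesis
      unfolding closed_sequential_limits
    proof (intro allI impI)
      fix X x assume X: "(\<forall>n. X n \<in> span (insert b B)) \<and> X \<longlonglongrightarrow> x"
      then have "\<forall>n. \<exists>c. X n - c *\<^sub>R b \<in> span B" by (simp add: span_insert)
      then obtain c where c: "\<And>n. X n - c n *\<^sub>R b \<in> span B" by metis
      have le: "\<bar>c m - c n\<bar> * d \<le> norm (X m - X n)" for m n
      proof -
        have "(X m - c m *\<^sub>R b) - (X n - c n *\<^sub>R b) \<in> span B" by (intro span_diff c)
        from d(2)[OF this, of "c m - c n"] show ?thesis by (simp add: algebra_simps)
      qed
      have "Cauchy X" using X LIMSEQ_imp_Cauchy by blast
      have "Cauchy c"
      proof (rule CauchyI)
        fix e :: real assume "0 < e"
        then have "0 < e * d" using d by simp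
        from CauchyD[OF \<open>Cauchy X\<close> this] obtain M where
          M: "\<forall>m\<ge>M. \<forall>n\<ge>M. norm (X m - X n) < e * d" by blast
        have "norm (c m - c n) < e" if "m \<ge> M" "n \<ge> M" for m n
        proof -
          have "\<bar>c m - c n\<bar> * d < e * d" using le[of m n] M that by fastforce
          then show ?thesis using d by simp
        qed
        then show "\<exists>M. \<forall>m\<ge>M. \<forall>n\<ge>M. norm (c m - c n) < e" by blast
      qed
      then obtain l where l: "c \<longlonglongrightarrow> l" using real_Cauchy_convergent convergentD by blast
      have "(\<lambda>n. X n - c n *\<^sub>R b) \<longlonglongrightarrow> x - l *\<^sub>R b"
        using X l by (intro tendsto_intros) auto
      then have "x - l *\<^sub>R b \<in> span B"
        by (rule closed_sequentially[OF insert.IH c])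
      then show "x \<in> span (insert b B)" unfolding span_insert by blast
    qed
  qed
qed simp

lemma finite_dim_basis:
  assumes "finite_dim TYPE('c::real_vector)"
  shows "\<exists>B :: 'c set. finite B \<and> independent B \<and> span B = UNIV"
proof -
  obtain B0 :: "'c set" where B0: "finite B0" "span B0 = UNIV"
    using assms by (auto simp: finite_dim_def)
  obtain B where B: "B \<subseteq> B0" "independent B" "B0 \<subseteq> span B"
    using maximal_independent_subset by blast
  have "span B = UNIV" using B B0 by (metis span_mono span_span top.extremum_uniqueI)
  moreover have "finite B" using B B0 finite_subset by blast
  ultimately show ?thesis using B by blast
qed

text \<open>The coordinate at b is continuous because b has positive distance from the span of the
  other basis vectors; a lower bound d for it gives the bound 1/d.\<close>

lemma finite_dim_coordinates:
  assumes "finite_dim TYPE('c::real_normed_vector)"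
  obtains B :: "'c::real_normed_vector set" and e where "finite B" "\<And>b. bounded_linear (e b)"
    "\<And>x. (\<Sum>b\<in>B. e b x *\<^sub>R b) = x"
proof -
  obtain B :: "'c set" where fin: "finite B" and ind: "independent B" and sp: "span B = UNIV"
    using finite_dim_basis[OF assms(1)] by (elim exE conjE)
  define e where "e = (\<lambda>b x. representation B x b)"
  have sum: "(\<Sum>b\<in>B. e b x *\<^sub>R b) = x" for x
    unfolding e_def using ind fin sp by (intro sum_representation_eq) auto
  have "bounded_linear (e b)" for b
  proof (cases "b \<in> B")
    \<comment> \<open>\<open>representation\<close> is zero off the basis, so boundedness holds for
      every index b.\<close>
    case False
    then have "e b = (\<lambda>x. 0)" unfolding e_def using representation_ne_zero by fastforce
    then show ?thesis by simp
  next
    case True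
    have nin: "b \<notin> span (B - {b})" using ind True by (auto simp: dependent_def)
    have cl: "closed (span (B - {b}))" using fin by (intro closed_span_finite) auto
    obtain d where d: "d > 0" "\<And>c v. v \<in> span (B - {b}) \<Longrightarrow> \<bar>c\<bar> * d \<le> norm (c *\<^sub>R b + v)"
      using insert_span_bound[OF cl nin] by blast
    have bound: "\<bar>e b x\<bar> \<le> norm x * (1 / d)" for x
    proof -
      have "(\<Sum>b'\<in>B - {b}. e b' x *\<^sub>R b') \<in> span (B - {b})"
        by (intro span_sum span_scale span_base) auto
      moreover have "e b x *\<^sub>R b + (\<Sum>b'\<in>B - {b}. e b' x *\<^sub>R b') = x"
        using sum.remove[OF fin True, of "\<lambda>b'. e b' x *\<^sub>R b'"] sum[of x] by simp
      ultimately have "\<bar>e b x\<bar> * d \<le> norm x" using d(2) by metis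
      then show ?thesis using d(1) by (simp add: field_simps)
    qed
    show ?thesis
    proof (rule bounded_linear_intro[of _ "1 / d"])
      show "norm (e b x) \<le> norm x * (1 / d)" for x using bound by simp
    qed (simp_all add: e_def representation_add representation_scale ind sp)
  qed
  with fin sum that show ?thesis by blast
qed

lemma finite_dim_linear_bounded:
  fixes h :: "'c::real_normed_vector \<Rightarrow> 'd::real_normed_vector"
  assumes "finite_dim TYPE('c)" "linear h"
  shows "bounded_linear h"
proof -
  obtain B :: "'c set" and e where B: "finite B" "\<And>b. bounded_linear (e b)"
    "\<And>x. (\<Sum>b\<in>B. e b x *\<^sub>R b) = x"
    using finite_dim_coordinates[OF assms(1)] by blast
  have "h = (\<lambda>x. \<Sum>b\<in>B. e b x *\<^sub>R h b)"
  proof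
    fix x
    have "h x = h (\<Sum>b\<in>B. e b x *\<^sub>R b)" by (simp add: B)
    also have "\<dots> = (\<Sum>b\<in>B. e b x *\<^sub>R h b)"
      using assms(2) by (simp add: linear_sum linear_scale)
    finally show "h x = (\<Sum>b\<in>B. e b x *\<^sub>R h b)" .
  qed
  moreover have "bounded_linear (\<lambda>x. \<Sum>b\<in>B. e b x *\<^sub>R h b)"
    by (intro bounded_linear_sum bounded_linear_scaleR_const B)
  ultimately show ?thesis by simp
qed

text \<open>The ball is a closed subset of a coordinate box, and the box is compact as a continuous
  image of a product of intervals, built one basis vector at a time.\<close>

lemma compact_cball_finite_dim:
  fixes x :: "'c::real_normed_vector"
  assumes "finite_dim TYPE('c)"
  shows "compact (cball x r)"
proof -
  obtain B :: "'c set" and e where B: "finite B" "\<And>b. bounded_linear (e b)"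
    "\<And>x. (\<Sum>b\<in>B. e b x *\<^sub>R b) = x"
    using finite_dim_coordinates[OF assms(1)] by blast
  define K where "K = (\<lambda>(S :: 'c set) M. {\<Sum>b\<in>S. c b *\<^sub>R b | c. \<forall>b\<in>S. \<bar>c b :: real\<bar> \<le> M b})"
  have compact: "compact (K S M)" if "finite S" for S :: "'c set" and M
    using that
  proof induction
    case empty
    have "K {} M = {0}" by (auto simp: K_def)
    then show ?case by simp
  next
    case (insert b S)
    have "K (insert b S) M = (\<lambda>(t, y). t *\<^sub>R b + y) ` ({- M b..M b} \<times> K S M)"
    proof (intro equalityI subsetI)
      fix z assume "z \<in> K (insert b S) M"
      then obtain c where c: "z = (\<Sum>b\<in>insert b S. c b *\<^sub>R b)" "\<forall>b\<in>insert b S. \<bar>c b\<bar> \<le> M b"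
        by (auto simp: K_def)
      then have "z = (\<lambda>(t, y). t *\<^sub>R b + y) (c b, \<Sum>b\<in>S. c b *\<^sub>R b)"
        using insert by simp
      moreover have "(c b, \<Sum>b\<in>S. c b *\<^sub>R b) \<in> {- M b..M b} \<times> K S M"
        using c by (auto simp: K_def abs_le_iff)
      ultimately show "z \<in> (\<lambda>(t, y). t *\<^sub>R b + y) ` ({- M b..M b} \<times> K S M)" by blast
    next
      fix z assume "z \<in> (\<lambda>(t, y). t *\<^sub>R b + y) ` ({- M b..M b} \<times> K S M)"
      then obtain t c where c: "z = t *\<^sub>R b + (\<Sum>b\<in>S. c b *\<^sub>R b)" "\<bar>t\<bar> \<le> M b" "\<forall>b\<in>S. \<bar>c b\<bar> \<le> M b"
        by (auto simp: K_def)
      \<comment> \<open>Changing the coefficient at b leaves the sum over S alone since b lies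
        outside S.\<close>
      have "(\<Sum>b'\<in>S. (c(b := t)) b' *\<^sub>R b') = (\<Sum>b\<in>S. c b *\<^sub>R b)"
        by (rule sum.cong) (use insert in auto)
      then have "z = (\<Sum>b'\<in>insert b S. (c(b := t)) b' *\<^sub>R b')" "\<forall>b'\<in>insert b S. \<bar>(c(b := t)) b'\<bar> \<le> M b'"
        using insert c by auto
      then show "z \<in> K (insert b S) M" unfolding K_def by blast
    qed
    moreover have "compact ((\<lambda>(t, y). t *\<^sub>R b + y) ` ({- M b..M b} \<times> K S M))"
      by (intro compact_continuous_image compact_Times insert.IH compact_Icc)
        (auto simp: case_prod_unfold intro!: continuous_intros)
    ultimately show ?case by simp
  qed
  \<comment> \<open>Every y in the ball has norm at most \<open>norm x + r\<close>, so its
    coordinate at b is bounded by \<open>M b\<close>.\<close>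
  define M where "M = (\<lambda>b. onorm (e b) * (norm x + r))"
  have "cball x r \<subseteq> K B M"
  proof
    fix y assume y: "y \<in> cball x r"
    have "\<bar>e b y\<bar> \<le> M b" for b
    proof -
      have "norm y \<le> norm x + r" using y norm_triangle_sub[of y x] by (auto simp: dist_norm norm_minus_commute)
      then have "onorm (e b) * norm y \<le> M b"
        unfolding M_def by (intro mult_left_mono onorm_pos_le B)
      then show ?thesis using onorm[OF B(2), of b y] by simp
    qed
    then show "y \<in> K B M" unfolding K_def by (intro CollectI exI[of _ "\<lambda>b. e b y"]) (simp add: B)
  qed
  then have "cball x r = K B M \<inter> cball x r" by blast
  then show ?thesis using compact_Int_closed[OF compact[OF B(1)] closed_cball] by metis
qed

text \<open>The rank-one maps \<open>E b c\<close> (matrix units) span: the coefficient of g at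
  \<open>E b c\<close> is the c-coordinate of \<open>g b\<close>.\<close>

lemma finite_dim_blinfun:
  assumes "finite_dim TYPE('c::real_normed_vector)" "finite_dim TYPE('d::real_normed_vector)"
  shows "finite_dim TYPE('c \<Rightarrow>\<^sub>L 'd)"
proof -
  obtain B :: "'c set" and e where B: "finite B" "\<And>b. bounded_linear (e b)"
    "\<And>x. (\<Sum>b\<in>B. e b x *\<^sub>R b) = x"
    using finite_dim_coordinates[OF assms(1)] by blast
  obtain C :: "'d set" and k where C: "finite C" "\<And>b. bounded_linear (k b)"
    "\<And>x. (\<Sum>b\<in>C. k b x *\<^sub>R b) = x"
    using finite_dim_coordinates[OF assms(2)] by blast
  define E where "E = (\<lambda>b c. Blinfun (\<lambda>x. e b x *\<^sub>R (c::'d)))"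
  have E: "E b c x = e b x *\<^sub>R c" for b c x
    unfolding E_def by (simp add: bounded_linear_Blinfun_apply bounded_linear_scaleR_const B)
  let ?S = "(\<lambda>(b, c). E b c) ` (B \<times> C)"
  have "g \<in> span ?S" for g
  proof -
    have "g = (\<Sum>b\<in>B. \<Sum>c\<in>C. k c (g b) *\<^sub>R E b c)"
    proof (rule blinfun_eqI)
      fix x
      have "(\<Sum>b\<in>B. \<Sum>c\<in>C. k c (g b) *\<^sub>R E b c) x = (\<Sum>b\<in>B. e b x *\<^sub>R (\<Sum>c\<in>C. k c (g b) *\<^sub>R c))"
        by (simp add: blinfun.sum_left blinfun.scaleR_left E scaleR_sum_right mult.commute)
      also have "\<dots> = g (\<Sum>b\<in>B. e b x *\<^sub>R b)"
        by (simp add: C blinfun.sum_right blinfun.scaleR_right)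
      finally show "g x = (\<Sum>b\<in>B. \<Sum>c\<in>C. k c (g b) *\<^sub>R E b c) x" by (simp add: B)
    qed
    moreover have "(\<Sum>b\<in>B. \<Sum>c\<in>C. k c (g b) *\<^sub>R E b c) \<in> span ?S"
      by (intro span_sum span_scale span_base) auto
    ultimately show ?thesis by simp
  qed
  then show ?thesis unfolding finite_dim_def using B(1) C(1)
    by (intro exI[of _ ?S]) auto
qed

lemma finite_dim_inj_inverse:
  fixes A :: "'c::real_normed_vector \<Rightarrow>\<^sub>L 'c"
  assumes "finite_dim TYPE('c)" "inj (blinfun_apply A)"
  obtains W where "W o\<^sub>L A = id_blinfun" "A o\<^sub>L W = id_blinfun"
proof -
  obtain B :: "'c set" where fin: "finite B" and ind: "independent B" and sp: "span B = UNIV"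
    using finite_dim_basis[OF assms(1)] by (elim exE conjE)
  have lin: "linear (blinfun_apply A)" by (simp add: bounded_linear.linear blinfun.bounded_linear_right)
  have indep: "independent (A ` B)"
    using ind lin assms(2) by (metis inj_on_subset linear_independent_injective_image subset_UNIV)
  have "span (A ` B) = UNIV"
  \<comment> \<open>A vector outside the span could be adjoined to the image of B, giving an
    independent set with one element more than the spanning set B.\<close>
  proof (rule ccontr)
    assume "span (A ` B) \<noteq> UNIV"
    then obtain w where w: "w \<notin> span (A ` B)" by blast
    then have "independent (insert w (A ` B))" using indep independent_insertI by blast
    then have "card (insert w (A ` B)) \<le> card B"
      using independent_span_bound[OF fin] sp by blast
    moreover have "w \<notin> A ` B" using w span_superset[of "A ` B"] by auto
    moreover have "card (A ` B) = card B" using assms(2) by (simp add: card_image inj_on_subset)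
    ultimately show False using fin by simp
  qed
  then have surj: "surj (blinfun_apply A)"
    using linear_span_image[OF lin, of B] sp by simp
  define W where "W = inv (blinfun_apply A)"
  have WA: "W (A x) = x" and AW: "A (W x) = x" for x
    using assms(2) surj by (auto simp: W_def inv_f_f surj_f_inv_f)
  have "linear W"
    by (rule linearI; rule injD[OF assms(2)])
      (simp_all add: AW blinfun.add_right blinfun.scaleR_right)
  then have bW: "bounded_linear W" using assms(1) by (intro finite_dim_linear_bounded)
  show ?thesis
    by (rule that[of "Blinfun W"]; rule blinfun_eqI)
      (simp_all add: bounded_linear_Blinfun_apply[OF bW] WA AW)
qed

section \<open>Smoothness of polynomial maps\<close>

text \<open>Since S is open, derivatives at its points depend only on the values on S, so the
  induction hypothesis applies to the directional derivatives.\<close>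

lemma Ck_on_cong:
  assumes "open S" "\<And>x. x \<in> S \<Longrightarrow> g x = h x" "Ck_on k S g"
  shows "Ck_on k S h"
  using assms(2,3)
proof (induction k arbitrary: g h)
  case 0
  then show ?case using continuous_on_cong by force
next
  case (Suc k)
  have der: "(h has_derivative frechet_derivative g (at x)) (at x)" if "x \<in> S" for x
    using Suc.prems(2) that
    by (intro has_derivative_transform_within_open[OF _ assms(1) that Suc.prems(1)])
      (auto simp: frechet_derivative_works)
  show ?case
    unfolding Ck_on.simps
  proof (intro conjI ballI allI)
    show "h differentiable at x" if "x \<in> S" for x
      using der[OF that] by (auto simp: differentiable_def)
    show "Ck_on k S (\<lambda>x. frechet_derivative h (at x) v)" for v
    proof (rule Suc.IH)
      show "Ck_on k S (\<lambda>x. frechet_derivative g (at x) v)" using Suc.prems by simp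
      show "frechet_derivative g (at x) v = frechet_derivative h (at x) v" if "x \<in> S" for x
        using frechet_derivative_at[OF der[OF that]] by simp
    qed
  qed
qed

text \<open>The derivative of \<open>g \<circ> L\<close> in direction v is the derivative of g in
  direction \<open>L v\<close>, again composed with L; hence the induction generalizes over
  g.\<close>

lemma Ck_on_compose_bounded_linear:
  assumes L: "bounded_linear L" and T: "open T" "L ` T \<subseteq> S" and g: "Ck_on k S g"
  shows "Ck_on k T (\<lambda>x. g (L x))"
  using g
proof (induction k arbitrary: g)
  case 0
  then have "continuous_on S g" by simp
  then show ?case
    using T continuous_on_compose2[OF _ linear_continuous_on[OF L]] by auto
next
  case (Suc k)
  have der: "((\<lambda>x. g (L x)) has_derivative (\<lambda>v. frechet_derivative g (at (L x)) (L v))) (at x)"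
    if "x \<in> T" for x
  proof -
    have "(g has_derivative frechet_derivative g (at (L x))) (at (L x))"
      using Suc.prems T that by (auto simp flip: frechet_derivative_works)
    then show ?thesis
      by (rule has_derivative_compose[OF bounded_linear_imp_has_derivative[OF L]])
  qed
  show ?case
    unfolding Ck_on.simps
  proof (intro conjI ballI allI)
    show "(\<lambda>x. g (L x)) differentiable at x" if "x \<in> T" for x
      using der[OF that] by (auto simp: differentiable_def)
    show "Ck_on k T (\<lambda>x. frechet_derivative (\<lambda>x. g (L x)) (at x) v)" for v
    proof (rule Ck_on_cong[OF T(1)])
      show "Ck_on k T (\<lambda>x. frechet_derivative g (at (L x)) (L v))"
        using Suc by auto
      show "frechet_derivative g (at (L x)) (L v) = frechet_derivative (\<lambda>x. g (L x)) (at x) v"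
        if "x \<in> T" for x
        using frechet_derivative_at[OF der[OF that]] by (metis (no_types))
    qed
  qed
qed

text \<open>The direction \<xi> may vary with the point: differentiating a polynomial along a
  polynomial vector field gives a polynomial. This form is what differentiating solutions of a
  polynomial differential equation calls for.\<close>

lemma real_polynomial_function_has_derivative:
  assumes "real_polynomial_function p"
  shows "\<exists>p'. (\<forall>x. (p has_derivative p' x) (at x)) \<and>
    (\<forall>\<xi>. polynomial_function \<xi> \<longrightarrow> real_polynomial_function (\<lambda>x. p' x (\<xi> x)))"
  using assms
proof induction
  case (linear f)
  have "real_polynomial_function (\<lambda>x. f (\<xi> x))" if "polynomial_function \<xi>" for \<xi>
    using linear that by (auto simp: polynomial_function_def o_def)
  then show ?case
    using bounded_linear_imp_has_derivative[OF linear]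
    by (intro exI[of _ "\<lambda>_. f"] conjI allI impI)
next
  case (const c)
  show ?case
    by (intro exI[of _ "\<lambda>_ _. 0"] conjI allI impI) (auto intro: real_polynomial_function.intros)
next
  case (add f g)
  obtain f' where f': "\<forall>x. (f has_derivative f' x) (at x)"
    "\<forall>\<xi>. polynomial_function \<xi> \<longrightarrow> real_polynomial_function (\<lambda>x. f' x (\<xi> x))"
    using add.IH(1) by (elim exE conjE)
  obtain g' where g': "\<forall>x. (g has_derivative g' x) (at x)"
    "\<forall>\<xi>. polynomial_function \<xi> \<longrightarrow> real_polynomial_function (\<lambda>x. g' x (\<xi> x))"
    using add.IH(2) by (elim exE conjE)
  show ?case
    by (intro exI[of _ "\<lambda>x v. f' x v + g' x v"] conjI allI impI
        has_derivative_add real_polynomial_function.intros(3)) (simp_all add: f' g')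
next
  case (mult f g)
  obtain f' where f': "\<forall>x. (f has_derivative f' x) (at x)"
    "\<forall>\<xi>. polynomial_function \<xi> \<longrightarrow> real_polynomial_function (\<lambda>x. f' x (\<xi> x))"
    using mult.IH(1) by (elim exE conjE)
  obtain g' where g': "\<forall>x. (g has_derivative g' x) (at x)"
    "\<forall>\<xi>. polynomial_function \<xi> \<longrightarrow> real_polynomial_function (\<lambda>x. g' x (\<xi> x))"
    using mult.IH(2) by (elim exE conjE)
  show ?case
    by (intro exI[of _ "\<lambda>x v. f x * g' x v + f' x v * g x"] conjI allI impI
        has_derivative_mult real_polynomial_function.intros(3,4) mult.hyps)
      (simp_all add: f' g')
qed

lemma polynomial_function_compose_bounded_linear:
  fixes h :: "'c::real_normed_vector \<Rightarrow> 'd::real_normed_vector"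
  assumes "bounded_linear h" "polynomial_function G"
  shows "polynomial_function (\<lambda>x. h (G x))"
  unfolding polynomial_function_def o_def
proof (intro allI impI)
  fix f :: "'d \<Rightarrow> real" assume "bounded_linear f"
  then have "bounded_linear (\<lambda>x. f (h x))" using assms(1) by (rule bounded_linear_compose)
  from assms(2)[unfolded polynomial_function_def o_def, rule_format, OF this]
  show "real_polynomial_function (\<lambda>x. f (h (G x)))" .
qed

text \<open>Reduces to the real-valued case through the coordinates of the target, which are
  finitely many and bounded linear.\<close>

lemma polynomial_function_has_derivative:
  fixes G :: "'x::real_normed_vector \<Rightarrow> 'e::real_normed_vector"
  assumes fd: "finite_dim TYPE('e)" and G: "polynomial_function G"
  shows "\<exists>G'. (\<forall>x. (G has_derivative G' x) (at x)) \<and>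
    (\<forall>\<xi>. polynomial_function \<xi> \<longrightarrow> polynomial_function (\<lambda>x. G' x (\<xi> x)))"
proof -
  obtain B :: "'e set" and e where B: "finite B" "\<And>b. bounded_linear (e b)"
    "\<And>x. (\<Sum>b\<in>B. e b x *\<^sub>R b) = x"
    using finite_dim_coordinates[OF fd] by blast
  have "real_polynomial_function (\<lambda>x. e b (G x))" for b
    using G B(2) by (simp add: polynomial_function_def o_def)
  then have "\<forall>b. \<exists>p'. (\<forall>x. ((\<lambda>x. e b (G x)) has_derivative p' x) (at x)) \<and>
    (\<forall>\<xi>. polynomial_function \<xi> \<longrightarrow> real_polynomial_function (\<lambda>x. p' x (\<xi> x)))"
    using real_polynomial_function_has_derivative by blast
  then obtain p' where "\<forall>b. (\<forall>x. ((\<lambda>x. e b (G x)) has_derivative p' b x) (at x)) \<and>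
    (\<forall>\<xi>. polynomial_function \<xi> \<longrightarrow> real_polynomial_function (\<lambda>x. p' b x (\<xi> x)))"
    by (rule choice[THEN exE])
  then have p': "((\<lambda>x. e b (G x)) has_derivative p' b x) (at x)"
    "polynomial_function \<xi> \<Longrightarrow> polynomial_function (\<lambda>x. p' b x (\<xi> x))" for b x \<xi>
    by (simp_all flip: real_polynomial_function_eq)
  have "((\<lambda>x. \<Sum>b\<in>B. e b (G x) *\<^sub>R b) has_derivative (\<lambda>v. \<Sum>b\<in>B. p' b x v *\<^sub>R b)) (at x)" for x
    by (intro has_derivative_sum has_derivative_scaleR_left p')
  then have "(G has_derivative (\<lambda>v. \<Sum>b\<in>B. p' b x v *\<^sub>R b)) (at x)" for x by (simp add: B)
  moreover have "polynomial_function (\<lambda>x. \<Sum>b\<in>B. p' b x (\<xi> x) *\<^sub>R b)"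
    if "polynomial_function \<xi>" for \<xi>
    by (intro polynomial_function_sum B polynomial_function_mult p' that polynomial_function_const)
  ultimately show ?thesis
    by (intro exI[of _ "\<lambda>x v. \<Sum>b\<in>B. p' b x v *\<^sub>R b"] conjI allI impI)
qed

text \<open>
  Along a map whose directional derivatives are polynomial expressions in the map itself, the
  class of polynomial expressions is closed under differentiation.
\<close>

lemma smooth_on_polynomial_compose:
  fixes u :: "'c::real_normed_vector \<Rightarrow> 'x::real_normed_vector"
    and G :: "'x \<Rightarrow> 'e::real_normed_vector"
  assumes fd: "finite_dim TYPE('e)" and S: "open S"
    and u: "\<And>y. y \<in> S \<Longrightarrow> (u has_derivative u' y) (at y)"
    and \<xi>: "\<And>v. polynomial_function (\<xi> v)" "\<And>y v. y \<in> S \<Longrightarrow> u' y v = \<xi> v (u y)"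
    and G: "polynomial_function G"
  shows "smooth_on S (\<lambda>y. G (u y))"
proof -
  have "Ck_on k S (\<lambda>y. G (u y))" for k
    using G
  proof (induction k arbitrary: G)
    case 0
    then obtain G' where "\<forall>x. (G has_derivative G' x) (at x)"
      using polynomial_function_has_derivative[OF fd 0] by (elim exE conjE)
    then have "((\<lambda>y. G (u y)) has_derivative (\<lambda>v. G' (u y) (u' y v))) (at y)" if "y \<in> S" for y
      using has_derivative_compose[OF u[OF that]] by blast
    then have "continuous (at y) (\<lambda>y. G (u y))" if "y \<in> S" for y
      using that has_derivative_continuous by blast
    then show ?case by (simp add: continuous_at_imp_continuous_on)
  next
    case (Suc k)
    obtain G' where G': "\<forall>x. (G has_derivative G' x) (at x)"
      "\<forall>\<xi>. polynomial_function \<xi> \<longrightarrow> polynomial_function (\<lambda>x. G' x (\<xi> x))"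
      using polynomial_function_has_derivative[OF fd Suc.prems] by (elim exE conjE)
    \<comment> \<open>Substituting \<open>u' y v = \<xi> v (u y)\<close> turns the derivative into a
      polynomial in \<open>u y\<close> again, so the induction hypothesis applies with this new
      polynomial in place of G.\<close>
    have der: "((\<lambda>y. G (u y)) has_derivative (\<lambda>v. G' (u y) (\<xi> v (u y)))) (at y)" if "y \<in> S" for y
      using has_derivative_compose[OF u[OF that] G'(1)[rule_format]] \<xi>(2)[OF that] by simp
    show ?case
      unfolding Ck_on.simps
    proof (intro conjI ballI allI)
      show "(\<lambda>y. G (u y)) differentiable at y" if "y \<in> S" for y
        using der[OF that] by (auto simp: differentiable_def)
      show "Ck_on k S (\<lambda>y. frechet_derivative (\<lambda>y. G (u y)) (at y) v)" for v
      proof (rule Ck_on_cong[OF S])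
        show "Ck_on k S (\<lambda>y. G' (u y) (\<xi> v (u y)))"
          by (rule Suc.IH[OF G'(2)[rule_format, OF \<xi>(1)]])
        show "G' (u y) (\<xi> v (u y)) = frechet_derivative (\<lambda>y. G (u y)) (at y) v" if "y \<in> S" for y
          using frechet_derivative_at[OF der[OF that]] by (metis (no_types))
      qed
    qed
  qed
  then show ?thesis by (simp add: smooth_on_def)
qed

text \<open>The identity map has constant directional derivatives, so this is the case
  \<open>u y = y\<close>.\<close>

lemma smooth_on_polynomial_function:
  fixes G :: "'x::real_normed_vector \<Rightarrow> 'e::real_normed_vector"
  assumes "finite_dim TYPE('e)" "open S" "polynomial_function G"
  shows "smooth_on S G"
  using smooth_on_polynomial_compose[OF assms(1,2) has_derivative_ident _ _ assms(3), of "\<lambda>v _. v"]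
  by simp

section \<open>Polynomial dependence of operators and multilinear expressions\<close>

lemma polynomial_function_blinfun_apply:
  fixes A :: "'x::real_normed_vector \<Rightarrow> 'c::real_normed_vector \<Rightarrow>\<^sub>L 'd::real_normed_vector"
  assumes fd: "finite_dim TYPE('c)" and A: "polynomial_function A" and w: "polynomial_function w"
  shows "polynomial_function (\<lambda>x. A x (w x))"
proof -
  obtain B :: "'c set" and e where B: "finite B" "\<And>b. bounded_linear (e b)"
    "\<And>x. (\<Sum>b\<in>B. e b x *\<^sub>R b) = x"
    using finite_dim_coordinates[OF fd] by blast
  have "A x (w x) = (\<Sum>b\<in>B. e b (w x) *\<^sub>R A x b)" for x
  proof -
    have "A x (w x) = A x (\<Sum>b\<in>B. e b (w x) *\<^sub>R b)" by (simp add: B)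
    then show ?thesis by (simp only: blinfun.sum_right blinfun.scaleR_right)
  qed
  moreover have "polynomial_function (\<lambda>x. \<Sum>b\<in>B. e b (w x) *\<^sub>R A x b)"
    by (intro polynomial_function_sum B polynomial_function_mult
        polynomial_function_compose_bounded_linear[OF B(2) w]
        polynomial_function_compose_bounded_linear[OF blinfun.bounded_linear_left A])
  ultimately show ?thesis by simp
qed

text \<open>Pointwise polynomial dependence is enough because \<open>A x\<close> is recovered
  linearly from its values on a basis through the rank-one maps \<open>E b w\<close>.\<close>

lemma polynomial_function_blinfunI:
  fixes A :: "'x::real_normed_vector \<Rightarrow> 'c::real_normed_vector \<Rightarrow>\<^sub>L 'd::real_normed_vector"
  assumes fd: "finite_dim TYPE('c)" "finite_dim TYPE('d)"
    and A: "\<And>v. polynomial_function (\<lambda>x. A x v)"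
  shows "polynomial_function A"
proof -
  obtain B :: "'c set" and e where B: "finite B" "\<And>b. bounded_linear (e b)"
    "\<And>x. (\<Sum>b\<in>B. e b x *\<^sub>R b) = x"
    using finite_dim_coordinates[OF fd(1)] by blast
  define E where "E = (\<lambda>b (w :: 'd). Blinfun (\<lambda>v. e b v *\<^sub>R w))"
  have E: "E b w v = e b v *\<^sub>R w" for b w v
    unfolding E_def by (simp add: bounded_linear_Blinfun_apply bounded_linear_scaleR_const B)
  have "linear (E b)" for b
    by (rule linearI; rule blinfun_eqI)
      (simp_all add: E blinfun.add_left blinfun.scaleR_left algebra_simps)
  then have bE: "bounded_linear (E b)" for b by (rule finite_dim_linear_bounded[OF fd(2)])
  have "A x = (\<Sum>b\<in>B. E b (A x b))" for x
  proof (rule blinfun_eqI)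
    fix v
    have "A x v = A x (\<Sum>b\<in>B. e b v *\<^sub>R b)" by (simp add: B)
    then show "A x v = (\<Sum>b\<in>B. E b (A x b)) v"
      by (simp only: blinfun.sum_right blinfun.sum_left blinfun.scaleR_right E)
  qed
  moreover have "polynomial_function (\<lambda>x. \<Sum>b\<in>B. E b (A x b))"
    by (intro polynomial_function_sum B polynomial_function_compose_bounded_linear[OF bE] A)
  ultimately show ?thesis by simp
qed

lemma polynomial_function_blinfun_compose:
  fixes A A' :: "'x::real_normed_vector \<Rightarrow> 'c::real_normed_vector \<Rightarrow>\<^sub>L 'c"
  assumes fd: "finite_dim TYPE('c)" and A: "polynomial_function A" "polynomial_function A'"
  shows "polynomial_function (\<lambda>x. A x o\<^sub>L A' x)"
  by (rule polynomial_function_blinfunI[OF fd fd])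
    (simp add: polynomial_function_blinfun_apply[OF fd] A)

text \<open>Expanding the linear argument in a basis leaves a sum of coordinates times
  \<open>G b x\<close>. Each application absorbs one linear argument of a multilinear map.\<close>

lemma polynomial_function_diagonal:
  fixes G :: "'c::real_normed_vector \<Rightarrow> 'c \<Rightarrow> 'd::real_normed_vector"
  assumes fd: "finite_dim TYPE('c)" and lin: "\<And>v. linear (\<lambda>u. G u v)"
    and pol: "\<And>u. polynomial_function (G u)"
  shows "polynomial_function (\<lambda>x. G x x)"
proof -
  obtain B :: "'c set" and e where B: "finite B" "\<And>b. bounded_linear (e b)"
    "\<And>x. (\<Sum>b\<in>B. e b x *\<^sub>R b) = x"
    using finite_dim_coordinates[OF fd] by blast
  have "G x y = (\<Sum>b\<in>B. e b x *\<^sub>R G b y)" for x y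
  proof -
    have "G x y = G (\<Sum>b\<in>B. e b x *\<^sub>R b) y" by (simp add: B)
    also have "\<dots> = (\<Sum>b\<in>B. e b x *\<^sub>R G b y)"
      by (simp only: linear_sum[OF lin] linear_scale[OF lin])
    finally show ?thesis .
  qed
  moreover have "polynomial_function (\<lambda>x. \<Sum>b\<in>B. e b x *\<^sub>R G b x)"
    by (intro polynomial_function_sum B polynomial_function_mult pol
        polynomial_function_bounded_linear)
  ultimately show ?thesis by (metis (no_types, lifting) ext)
qed

section \<open>The inverse function theorem for polynomial maps\<close>

lemma polynomial_function_Pair:
  assumes "polynomial_function f" "polynomial_function g"
  shows "polynomial_function (\<lambda>x. (f x, g x))"
proof -
  have "polynomial_function (\<lambda>x. (f x, 0) + (0, g x))"
    by (intro polynomial_function_add polynomial_function_compose_bounded_linear[OF _ assms(1)]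
        polynomial_function_compose_bounded_linear[OF _ assms(2)]
        bounded_linear_Pair bounded_linear_ident bounded_linear_zero)
  then show ?thesis by simp
qed

text \<open>Differentiability keeps the quotient of \<open>norm (A z - A y)\<close> by
  \<open>norm (z - y)\<close> bounded near y, while \<open>A z - A y\<close> itself tends to 0; so E
  is of smaller order than \<open>norm (z - y)\<close>.\<close>

lemma has_derivative_zero_if_quadratic_bound:
  fixes E :: "'y::real_normed_vector \<Rightarrow> 'z::real_normed_vector"
    and A :: "'y \<Rightarrow> 'w::real_normed_vector"
  assumes A: "(A has_derivative A') (at y)"
    and E: "E y = 0" "eventually (\<lambda>z. norm (E z) \<le> C * (norm (A z - A y))\<^sup>2) (nhds y)"
  shows "(E has_derivative (\<lambda>_. 0)) (at y)"
proof -
  interpret A': bounded_linear A' using A by (rule has_derivative_bounded_linear)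
  let ?r = "\<lambda>z. norm (A z - A y - A' (z - y)) / norm (z - y)"
  have r: "(?r \<longlongrightarrow> 0) (at y)"
    using A by (simp add: has_derivative_iff_norm)
  have dA: "((\<lambda>z. norm (A z - A y)) \<longlongrightarrow> 0) (at y)"
    using has_derivative_continuous[OF A] unfolding continuous_at
    by (simp add: LIM_zero tendsto_norm_zero)
  \<comment> \<open>At z = y both quotients have denominator 0 and hence value 0, and the operator
    norm is nonnegative.\<close>
  have bound: "norm (A z - A y) / norm (z - y) \<le> ?r z + onorm A'" for z
  proof (cases "z = y")
    case False
    have "norm (A z - A y) \<le> norm (A z - A y - A' (z - y)) + norm (A' (z - y))"
      using norm_triangle_ineq[of "A z - A y - A' (z - y)" "A' (z - y)"] by simp
    also have "norm (A' (z - y)) \<le> onorm A' * norm (z - y)"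
      by (rule onorm[OF A'.bounded_linear_axioms])
    finally show ?thesis using False by (simp add: field_simps)
  qed (simp add: onorm_pos_le[OF A'.bounded_linear_axioms])
  have lim: "((\<lambda>z. \<bar>C\<bar> * (norm (A z - A y) * (?r z + onorm A'))) \<longlongrightarrow> \<bar>C\<bar> * (0 * (0 + onorm A'))) (at y)"
    by (intro tendsto_intros r dA)
  have "eventually (\<lambda>z. norm (norm (E z) / norm (z - y))
      \<le> \<bar>C\<bar> * (norm (A z - A y) * (?r z + onorm A'))) (at y)"
    using eventually_nhds_conv_at[THEN iffD1, OF E(2), THEN conjunct1]
  proof eventually_elim
    case (elim z)
    have "norm (E z) / norm (z - y) \<le> \<bar>C\<bar> * (norm (A z - A y))\<^sup>2 / norm (z - y)"
      by (rule divide_right_mono)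
        (use elim mult_right_mono[OF abs_ge_self[of C], of "(norm (A z - A y))\<^sup>2"] in auto)
    also have "\<dots> = \<bar>C\<bar> * (norm (A z - A y) * (norm (A z - A y) / norm (z - y)))"
      by (simp add: power2_eq_square)
    also have "\<dots> \<le> \<bar>C\<bar> * (norm (A z - A y) * (?r z + onorm A'))"
      by (intro mult_left_mono bound) auto
    finally show ?case by simp
  qed
  then have "((\<lambda>z. norm (E z) / norm (z - y)) \<longlongrightarrow> 0) (at y)"
    by (rule Lim_null_comparison) (use lim in simp)
  then show ?thesis by (simp add: has_derivative_iff_norm E(1))
qed

text \<open>The rule that the derivative of the inverse is \<open>- W A' W\<close>. The bound M near
  y makes the remainder E quadratic in \<open>A z - A y\<close>.\<close>

lemma has_derivative_blinfun_inverse: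
  fixes A W :: "'y::real_normed_vector \<Rightarrow> 'c::real_normed_vector \<Rightarrow>\<^sub>L 'c"
  assumes V: "open V" "y \<in> V"
    and inv: "\<And>z. z \<in> V \<Longrightarrow> W z o\<^sub>L A z = id_blinfun" "\<And>z. z \<in> V \<Longrightarrow> A z o\<^sub>L W z = id_blinfun"
    and A: "(A has_derivative A') (at y)"
    and bound: "\<And>z. z \<in> V \<Longrightarrow> norm (W z) \<le> M"
  shows "(W has_derivative (\<lambda>h. - (W y o\<^sub>L A' h o\<^sub>L W y))) (at y)"
proof -
  define E where "E = (\<lambda>z. W z o\<^sub>L (A z - A y) o\<^sub>L W y o\<^sub>L (A z - A y) o\<^sub>L W y)"
  have WA: "W z (A z x) = x" and AW: "A z (W z x) = x" if "z \<in> V" for z x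
    using inv[OF that] by (metis blinfun_apply_blinfun_compose blinfun_apply_id_blinfun)+
  \<comment> \<open>the resolvent identity \<open>W z - W y = - W z (A z - A y) W y\<close>, substituted once into itself\<close>
  have W: "W y - (W y o\<^sub>L (A z - A y) o\<^sub>L W y) + E z = W z" if "z \<in> V" for z
    by (rule blinfun_eqI)
      (simp add: E_def blinfun.bilinear_simps WA[OF that] AW[OF that] WA[OF V(2)] AW[OF V(2)])
  have "(E has_derivative (\<lambda>_. 0)) (at y)"
  proof (rule has_derivative_zero_if_quadratic_bound[OF A])
    show "E y = 0" by (simp add: E_def)
    have "norm (E z) \<le> (M * norm (W y) * norm (W y)) * (norm (A z - A y))\<^sup>2" if "z \<in> V" for z
    proof -
      have "norm (E z) \<le> norm (W z) * norm (A z - A y) * norm (W y) * norm (A z - A y) * norm (W y)"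
        unfolding E_def
        by (intro order_trans[OF norm_blinfun_compose] mult_right_mono order_refl norm_ge_zero)
      also have "\<dots> \<le> M * norm (A z - A y) * norm (W y) * norm (A z - A y) * norm (W y)"
        by (intro mult_right_mono bound[OF that] norm_ge_zero)
      finally show ?thesis by (simp add: power2_eq_square algebra_simps)
    qed
    then show "eventually (\<lambda>z. norm (E z) \<le> (M * norm (W y) * norm (W y)) * (norm (A z - A y))\<^sup>2) (nhds y)"
      using V eventually_nhds by blast
  qed
  moreover have "((\<lambda>z. W y o\<^sub>L (A z - A y) o\<^sub>L W y) has_derivative (\<lambda>h. W y o\<^sub>L (A' h - 0) o\<^sub>L W y)) (at y)"
    by (intro bounded_linear.has_derivative[OF bounded_bilinear.bounded_linear_left[OF bounded_bilinear_blinfun_compose]]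
        bounded_linear.has_derivative[OF bounded_bilinear.bounded_linear_right[OF bounded_bilinear_blinfun_compose]]
        has_derivative_diff A has_derivative_const)
  ultimately have "((\<lambda>z. W y - (W y o\<^sub>L (A z - A y) o\<^sub>L W y) + E z) has_derivative
      (\<lambda>h. 0 - (W y o\<^sub>L (A' h - 0) o\<^sub>L W y) + 0)) (at y)"
    by (intro has_derivative_add has_derivative_diff has_derivative_const)
  then show ?thesis
    using has_derivative_transform_within_open[OF _ V W] by simp
qed

text \<open>By the triangle inequality \<open>norm v \<le> norm (A v) + norm v / 2\<close>, so
  \<open>norm v \<le> 2 * norm (A v)\<close>; this gives injectivity, and applied to
  \<open>W v\<close> it bounds the inverse by 2.\<close>

lemma near_identity_blinfun:
  fixes A :: "'c::real_normed_vector \<Rightarrow>\<^sub>L 'c"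
  assumes fd: "finite_dim TYPE('c)" and A: "norm (A - id_blinfun) \<le> 1/2"
  shows "\<exists>W. W o\<^sub>L A = id_blinfun \<and> A o\<^sub>L W = id_blinfun \<and> norm W \<le> 2"
proof -
  have le: "norm v \<le> 2 * norm (A v)" for v
  proof -
    have "norm (A v - v) \<le> 1/2 * norm v"
      using norm_blinfun[of "A - id_blinfun" v] mult_right_mono[OF A, of "norm v"]
      by (simp add: blinfun.diff_left)
    then show ?thesis using norm_triangle_sub[of v "A v"] by (simp add: norm_minus_commute)
  qed
  have "inj (blinfun_apply A)"
  proof (rule injI)
    fix v w assume "A v = A w"
    then show "v = w" using le[of "v - w"] by (simp add: blinfun.diff_right)
  qed
  then obtain W where W: "W o\<^sub>L A = id_blinfun" "A o\<^sub>L W = id_blinfun"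
    by (rule finite_dim_inj_inverse[OF fd])
  have "A (W v) = v" for v
    using W(2) by (metis blinfun_apply_blinfun_compose blinfun_apply_id_blinfun)
  then have "norm W \<le> 2" using le by (intro norm_blinfun_bound) (auto, metis)
  with W show ?thesis by blast
qed

text \<open>Near p the difference of \<phi> and the identity is a 1/2-contraction, so Banach's fixed
  point theorem produces preimages, and \<phi> shrinks distances at most by the factor 2. The
  inverse \<psi> is smooth since it and the inverse W of the derivative of \<phi> along it jointly
  solve a polynomial differential equation.\<close>

lemma polynomial_local_diffeomorphism:
  fixes \<phi> :: "'c::real_normed_vector \<Rightarrow> 'c"
  assumes fd: "finite_dim TYPE('c)" and \<phi>: "polynomial_function \<phi>"
    and id: "(\<phi> has_derivative (\<lambda>v. v)) (at p)" and S: "open S" "p \<in> S"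
  shows "\<exists>U V \<psi>. p \<in> U \<and> U \<subseteq> S \<and> diffeomorphism U V \<phi> \<psi> \<and>
    (\<psi> has_derivative (\<lambda>v. v)) (at (\<phi> p))"
proof -
  note fd2 = finite_dim_blinfun[OF fd fd]
  obtain D where D: "\<forall>x. (\<phi> has_derivative D x) (at x)"
    "\<forall>\<xi>. polynomial_function \<xi> \<longrightarrow> polynomial_function (\<lambda>x. D x (\<xi> x))"
    using polynomial_function_has_derivative[OF fd \<phi>] by (elim exE conjE)
  define A where "A = (\<lambda>x. Blinfun (D x))"
  have A: "blinfun_apply (A x) = D x" for x
    unfolding A_def using D(1) has_derivative_bounded_linear
    by (metis bounded_linear_Blinfun_apply)
  have \<phi>A: "(\<phi> has_derivative A x) (at x)" for x using D(1) A by simp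
  have polA: "polynomial_function A"
    by (rule polynomial_function_blinfunI[OF fd fd]) (simp add: A D(2))
  obtain D2 where D2: "\<forall>x. (A has_derivative D2 x) (at x)"
    using polynomial_function_has_derivative[OF fd2 polA] by (elim exE conjE)
  have Ap: "A p = id_blinfun"
    using has_derivative_unique[OF \<phi>A id] by (intro blinfun_eqI) simp
  have "isCont A p" using D2 has_derivative_continuous by blast
  then obtain d where d: "d > 0" "\<And>x. dist x p < d \<Longrightarrow> norm (A x - id_blinfun) < 1/2"
    using Ap unfolding continuous_at_eps_delta dist_norm
    by (metis half_gt_zero zero_less_one)
  obtain d' where d': "d' > 0" "ball p d' \<subseteq> S" using S by (meson open_contains_ball)
  define \<epsilon> where "\<epsilon> = min d d'"
  have \<epsilon>: "\<epsilon> > 0" "ball p \<epsilon> \<subseteq> S" using d d' by (auto simp: \<epsilon>_def)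
  have near: "norm (A x - id_blinfun) \<le> 1/2" if "x \<in> ball p \<epsilon>" for x
    using d(2)[of x] that by (auto simp: \<epsilon>_def dist_commute)
  have lip: "norm ((\<phi> x - x) - (\<phi> x' - x')) \<le> 1/2 * norm (x - x')"
    if "x \<in> ball p \<epsilon>" "x' \<in> ball p \<epsilon>" for x x'
  proof (rule differentiable_bound[OF convex_ball _ _ that])
    fix z assume z: "z \<in> ball p \<epsilon>"
    have "((\<lambda>x. \<phi> x - x) has_derivative (\<lambda>v. A z v - v)) (at z)"
      by (intro has_derivative_diff \<phi>A has_derivative_ident)
    moreover have "(\<lambda>v. A z v - v) = blinfun_apply (A z - id_blinfun)"
      by (simp add: fun_eq_iff blinfun.diff_left)
    ultimately show "((\<lambda>x. \<phi> x - x) has_derivative blinfun_apply (A z - id_blinfun)) (at z within ball p \<epsilon>)"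
      using has_derivative_at_withinI by metis
    show "onorm (blinfun_apply (A z - id_blinfun)) \<le> 1/2"
      using near[OF z] by (simp add: norm_blinfun.rep_eq)
  qed
  have expand: "norm (x - x') \<le> 2 * norm (\<phi> x - \<phi> x')" if "x \<in> ball p \<epsilon>" "x' \<in> ball p \<epsilon>" for x x'
  proof -
    have "norm (x - x') \<le> norm (\<phi> x - \<phi> x') + norm ((\<phi> x - x) - (\<phi> x' - x'))"
      using norm_triangle_ineq4[of "\<phi> x - \<phi> x'" "(\<phi> x - x) - (\<phi> x' - x')"] by simp
    then show ?thesis using lip[OF that] by simp
  qed
  \<comment> \<open>The radius is half of \<epsilon> because preimages of y are found within twice
    the distance from y to \<open>\<phi> p\<close>.\<close>
  define V where "V = ball (\<phi> p) (\<epsilon> / 2)"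
  define U where "U = ball p \<epsilon> \<inter> \<phi> -` V"
  have cont\<phi>: "continuous_on T \<phi>" for T
    using \<phi>A has_derivative_continuous by (metis continuous_at_imp_continuous_on)
  have opens: "open U" "open V"
    unfolding U_def V_def by (auto intro!: open_Int open_vimage cont\<phi>)
  have "\<exists>x\<in>U. \<phi> x = y" if y: "y \<in> V" for y
  proof -
    \<comment> \<open>Fixed points of \<open>y - (\<phi> x - x)\<close> are solutions of
      \<open>\<phi> x = y\<close>. This map displaces p by \<open>dist (\<phi> p) y\<close> and
      contracts by the factor 1/2, so it maps the closed ball of radius \<rho> about p into
      itself.\<close>
    define \<rho> where "\<rho> = 2 * dist (\<phi> p) y"
    have \<rho>: "\<rho> \<ge> 0" "\<rho> < \<epsilon>" using y by (auto simp: \<rho>_def V_def)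
    have sub: "cball p \<rho> \<subseteq> ball p \<epsilon>" using \<rho> by auto
    have "\<exists>!x. x \<in> cball p \<rho> \<and> y - (\<phi> x - x) = x"
    proof (rule Banach_fix)
      show "complete (cball p \<rho>)" by (intro compact_imp_complete compact_cball_finite_dim fd)
      show "cball p \<rho> \<noteq> {}" using \<rho> by simp
      show "(\<lambda>x. y - (\<phi> x - x)) ` cball p \<rho> \<subseteq> cball p \<rho>"
      proof (intro image_subsetI)
        fix x assume x: "x \<in> cball p \<rho>"
        have "p - (y - (\<phi> x - x)) = (\<phi> p - y) - ((\<phi> p - p) - (\<phi> x - x))" by simp
        then have "dist p (y - (\<phi> x - x)) \<le> dist (\<phi> p) y + norm ((\<phi> p - p) - (\<phi> x - x))"
          unfolding dist_norm by (metis norm_triangle_ineq4)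
        also have "\<dots> \<le> dist (\<phi> p) y + 1/2 * norm (p - x)"
          using lip[of p x] x sub \<epsilon> by auto
        also have "\<dots> \<le> \<rho>" using x by (simp add: \<rho>_def dist_norm)
        finally show "y - (\<phi> x - x) \<in> cball p \<rho>" by simp
      qed
      show "dist (y - (\<phi> x - x)) (y - (\<phi> x' - x')) \<le> 1/2 * dist x x'"
        if "x \<in> cball p \<rho>" "x' \<in> cball p \<rho>" for x x'
      proof -
        have "x \<in> ball p \<epsilon>" "x' \<in> ball p \<epsilon>" using that sub by blast+
        from lip[OF this(2,1)] show ?thesis by (simp add: dist_norm norm_minus_commute algebra_simps)
      qed
    qed auto
    then obtain x where "x \<in> cball p \<rho>" "y - (\<phi> x - x) = x" by blast
    then have "x \<in> ball p \<epsilon>" "\<phi> x = y" using sub by (auto simp: algebra_simps)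
    then show ?thesis using y by (auto simp: U_def)
  qed
  then obtain \<psi> where \<psi>: "\<And>y. y \<in> V \<Longrightarrow> \<psi> y \<in> U" "\<And>y. y \<in> V \<Longrightarrow> \<phi> (\<psi> y) = y"
    by metis
  have \<psi>\<phi>: "\<psi> (\<phi> x) = x" if "x \<in> U" for x
    using expand[of "\<psi> (\<phi> x)" x] \<psi>[of "\<phi> x"] that by (auto simp: U_def)
  have cont\<psi>: "continuous_on V \<psi>"
  proof (rule lipschitz_on_continuous_on)
    show "2-lipschitz_on V \<psi>"
    proof (rule lipschitz_onI)
      fix y y' assume y: "y \<in> V" "y' \<in> V"
      then have "\<psi> y \<in> ball p \<epsilon>" "\<psi> y' \<in> ball p \<epsilon>" using \<psi>(1) by (auto simp: U_def)
      from expand[OF this] show "dist (\<psi> y) (\<psi> y') \<le> 2 * dist y y'"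
        using \<psi>(2) y by (simp add: dist_norm)
    qed simp
  qed
  have "\<forall>x\<in>ball p \<epsilon>. \<exists>W. W o\<^sub>L A x = id_blinfun \<and> A x o\<^sub>L W = id_blinfun \<and> norm W \<le> 2"
    using near_identity_blinfun[OF fd near] by blast
  then obtain R where R: "\<And>x. x \<in> ball p \<epsilon> \<Longrightarrow> R x o\<^sub>L A x = id_blinfun"
    "\<And>x. x \<in> ball p \<epsilon> \<Longrightarrow> A x o\<^sub>L R x = id_blinfun" "\<And>x. x \<in> ball p \<epsilon> \<Longrightarrow> norm (R x) \<le> 2"
    by metis
  define W where "W = (\<lambda>y. R (\<psi> y))"
  have \<psi>b: "\<psi> y \<in> ball p \<epsilon>" if "y \<in> V" for y using \<psi>(1)[OF that] by (simp add: U_def)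
  have der\<psi>: "(\<psi> has_derivative W y) (at y)" if y: "y \<in> V" for y
  proof (rule has_derivative_inverse_basic[OF \<phi>A _ _ _ opens(2) y \<psi>(2)])
    show "blinfun_apply (W y) \<circ> blinfun_apply (A (\<psi> y)) = id"
      using R(1)[OF \<psi>b[OF y]] unfolding W_def
      by (metis (no_types, lifting) blinfun_apply_blinfun_compose blinfun_apply_id_blinfun comp_apply eq_id_iff ext)
    show "continuous (at y) \<psi>" using cont\<psi> opens(2) y by (simp add: continuous_on_eq_continuous_at)
  qed (auto intro: blinfun.bounded_linear_right)
  have derA: "((\<lambda>y. A (\<psi> y)) has_derivative (\<lambda>h. D2 (\<psi> y) (W y h))) (at y)" if "y \<in> V" for y
    using has_derivative_compose[OF der\<psi>[OF that] D2[rule_format]] .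
  have derW: "(W has_derivative (\<lambda>h. - (W y o\<^sub>L D2 (\<psi> y) (W y h) o\<^sub>L W y))) (at y)" if y: "y \<in> V" for y
    by (rule has_derivative_blinfun_inverse[OF opens(2) y _ _ derA[OF y], where M = 2])
      (simp_all add: W_def R[OF \<psi>b])
  define u where "u = (\<lambda>y. (\<psi> y, W y))"
  \<comment> \<open>A is read as a function on pairs so that its derivative is polynomial along
    directions that depend on the operator component as well as on the point.\<close>
  have polQ: "polynomial_function (\<lambda>x :: 'c \<times> ('c \<Rightarrow>\<^sub>L 'c). A (fst x))"
    using polynomial_function_compose[of fst A, OF _ polA]
    by (simp add: o_def polynomial_function_bounded_linear bounded_linear_fst)
  obtain D3 where D3: "\<forall>x. ((\<lambda>x :: 'c \<times> ('c \<Rightarrow>\<^sub>L 'c). A (fst x)) has_derivative D3 x) (at x)"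
    "\<forall>\<xi>. polynomial_function \<xi> \<longrightarrow> polynomial_function (\<lambda>x. D3 x (\<xi> x))"
    using polynomial_function_has_derivative[OF fd2 polQ] by (elim exE conjE)
  have "((\<lambda>x :: 'c \<times> ('c \<Rightarrow>\<^sub>L 'c). A (fst x)) has_derivative (\<lambda>h. D2 (fst x) (fst h))) (at x)" for x
    by (rule has_derivative_compose[of fst fst x UNIV A "D2 (fst x)"])
      (simp_all add: D2 bounded_linear_imp_has_derivative bounded_linear_fst)
  then have D3_eq: "D3 x = (\<lambda>h. D2 (fst x) (fst h))" for x
    using D3(1) has_derivative_unique by blast
  have pol_apply: "polynomial_function (\<lambda>x :: 'c \<times> ('c \<Rightarrow>\<^sub>L 'c). blinfun_apply (snd x) v)" for v
    by (intro polynomial_function_bounded_linear bounded_linear_compose[OF blinfun.bounded_linear_left bounded_linear_snd])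
  have pol_D2: "polynomial_function (\<lambda>x :: 'c \<times> ('c \<Rightarrow>\<^sub>L 'c). D2 (fst x) (blinfun_apply (snd x) v))" for v
    using D3(2)[rule_format, OF polynomial_function_Pair[OF pol_apply[of v] polynomial_function_const[of 0]]]
    by (simp add: D3_eq)
  \<comment> \<open>\<open>u\<close> solves the differential equation \<open>\<psi>' = W\<close>, \<open>W' = - W A'(\<psi>) W\<close>, whose right-hand side is polynomial\<close>
  define \<xi> where "\<xi> = (\<lambda>v (x :: 'c \<times> ('c \<Rightarrow>\<^sub>L 'c)). (blinfun_apply (snd x) v, - (snd x o\<^sub>L D2 (fst x) (blinfun_apply (snd x) v) o\<^sub>L snd x)))"
  have "smooth_on V (\<lambda>y. fst (u y))"
  proof (rule smooth_on_polynomial_compose[OF fd opens(2), where u = u and G = fst and \<xi> = \<xi>])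
    show "(u has_derivative (\<lambda>h. (W y h, - (W y o\<^sub>L D2 (\<psi> y) (W y h) o\<^sub>L W y)))) (at y)" if "y \<in> V" for y
      unfolding u_def by (intro has_derivative_Pair der\<psi> derW that)
    show "polynomial_function (\<xi> v)" for v
      unfolding \<xi>_def
      by (intro polynomial_function_Pair pol_apply polynomial_function_minus
          polynomial_function_blinfun_compose[OF fd] pol_D2
          polynomial_function_bounded_linear[OF bounded_linear_snd])
    show "polynomial_function (fst :: 'c \<times> ('c \<Rightarrow>\<^sub>L 'c) \<Rightarrow> 'c)"
      by (rule polynomial_function_bounded_linear[OF bounded_linear_fst])
  qed (simp add: \<xi>_def u_def)
  then have "smooth_on V \<psi>" by (simp add: u_def)
  moreover have "smooth_on U \<phi>" by (rule smooth_on_polynomial_function[OF fd opens(1) \<phi>])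
  moreover have "homeomorphism U V \<phi> \<psi>"
    by (rule homeomorphismI) (use cont\<phi> cont\<psi> \<psi> \<psi>\<phi> in \<open>auto simp: U_def\<close>)
  ultimately have "diffeomorphism U V \<phi> \<psi>" using opens by (simp add: diffeomorphism_def)
  moreover have pU: "p \<in> U" using \<epsilon> by (simp add: U_def V_def)
  moreover have "(\<psi> has_derivative (\<lambda>v. v)) (at (\<phi> p))"
  proof -
    have "\<phi> p \<in> V" using pU by (simp add: U_def)
    moreover have "W (\<phi> p) = id_blinfun"
      using R(1)[of p] \<epsilon>(1) \<psi>\<phi>[OF pU] Ap by (metis W_def blinfun_apply_blinfun_compose blinfun_apply_id_blinfun blinfun_eqI centre_in_ball)
    ultimately show ?thesis using der\<psi>[of "\<phi> p"] by simp
  qed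
  moreover have "U \<subseteq> S" using \<epsilon>(2) by (auto simp: U_def)
  ultimately show ?thesis by blast
qed

section \<open>The chart at a morphism\<close>

definition trilinear :: "('a::real_vector \<Rightarrow> 'b::real_vector \<Rightarrow> 'c::real_vector \<Rightarrow> 'd::real_vector) \<Rightarrow> bool" where
  "trilinear \<theta> \<longleftrightarrow> (\<forall>y z. linear (\<lambda>x. \<theta> x y z)) \<and> (\<forall>x z. linear (\<lambda>y. \<theta> x y z)) \<and>
     (\<forall>x y. linear (\<lambda>z. \<theta> x y z))"

text \<open>Iterated operators place cochains in a finite-dimensional normed space, where
  compactness and bounded linearity are available. The encoding is faithful for trilinear maps on a
  finite-dimensional space; alternation is kept as a separate condition.\<close>

definition blinfun3 :: "('a::real_normed_vector \<Rightarrow> 'a \<Rightarrow> 'a \<Rightarrow> 'b::real_normed_vector) \<Rightarrow> 'a \<Rightarrow>\<^sub>L 'a \<Rightarrow>\<^sub>L 'a \<Rightarrow>\<^sub>L 'b" where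
  "blinfun3 \<theta> = Blinfun (\<lambda>x. Blinfun (\<lambda>y. Blinfun (\<lambda>z. \<theta> x y z)))"

abbreviation apply3 :: "'a::real_normed_vector \<Rightarrow>\<^sub>L 'a \<Rightarrow>\<^sub>L 'a \<Rightarrow>\<^sub>L 'b::real_normed_vector \<Rightarrow> 'a \<Rightarrow> 'a \<Rightarrow> 'a \<Rightarrow> 'b" where
  "apply3 \<theta> x y z \<equiv> blinfun_apply (blinfun_apply (blinfun_apply \<theta> x) y) z"

lemma apply3_blinfun3:
  fixes \<theta> :: "'a::real_normed_vector \<Rightarrow> 'a \<Rightarrow> 'a \<Rightarrow> 'b::real_normed_vector"
  assumes fd: "finite_dim TYPE('a)" and \<theta>: "trilinear \<theta>"
  shows "apply3 (blinfun3 \<theta>) x y z = \<theta> x y z"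
proof -
  have 1: "Blinfun (\<lambda>z. \<theta> x y z) z = \<theta> x y z" for x y z
    using \<theta> by (simp add: trilinear_def bounded_linear_Blinfun_apply finite_dim_linear_bounded[OF fd])
  have lin: "\<theta> (x + x') y z = \<theta> x y z + \<theta> x' y z" "\<theta> (c *\<^sub>R x) y z = c *\<^sub>R \<theta> x y z"
    "\<theta> x (y + y') z = \<theta> x y z + \<theta> x y' z" "\<theta> x (c *\<^sub>R y) z = c *\<^sub>R \<theta> x y z" for x x' y y' z c
    using \<theta> by (simp_all add: trilinear_def linear_iff)
  have "linear (\<lambda>y. Blinfun (\<lambda>z. \<theta> x y z))" for x
    by (rule linearI; rule blinfun_eqI; simp only: 1 blinfun.add_left blinfun.scaleR_left; simp only: lin)
  then have 2: "Blinfun (\<lambda>y. Blinfun (\<lambda>z. \<theta> x y z)) y = Blinfun (\<lambda>z. \<theta> x y z)" for x y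
    by (simp add: bounded_linear_Blinfun_apply finite_dim_linear_bounded[OF fd])
  have "linear (\<lambda>x. Blinfun (\<lambda>y. Blinfun (\<lambda>z. \<theta> x y z)))"
    by (rule linearI; rule blinfun_eqI; rule blinfun_eqI;
        simp only: 1 2 blinfun.add_left blinfun.scaleR_left; simp only: lin)
  then have "blinfun3 \<theta> x = Blinfun (\<lambda>y. Blinfun (\<lambda>z. \<theta> x y z))" for x
    unfolding blinfun3_def by (simp add: bounded_linear_Blinfun_apply finite_dim_linear_bounded[OF fd])
  then show ?thesis by (simp add: 1 2)
qed

lemma blinfun3_eqI:
  "(\<And>x y z. apply3 \<theta> x y z = apply3 \<theta>' x y z) \<Longrightarrow> \<theta> = \<theta>'"
  by (simp add: blinfun_eqI)

locale finite_dim_three_lie_morphism =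
  fixes \<pi> :: "'a::real_normed_vector \<Rightarrow> 'a \<Rightarrow> 'a \<Rightarrow> 'a"
    and \<mu> :: "'b::real_normed_vector \<Rightarrow> 'b \<Rightarrow> 'b \<Rightarrow> 'b"
    and f :: "'a \<Rightarrow>\<^sub>L 'b"
  assumes fda: "finite_dim TYPE('a)" and fdb: "finite_dim TYPE('b)"
    and \<pi>: "three_lie_algebra \<pi>" and \<mu>: "three_lie_algebra \<mu>"
    and f: "three_lie_morphism \<pi> \<mu> f"
begin

lemmas fdHom = finite_dim_blinfun[OF fda fdb]
lemmas fdC2 = finite_dim_blinfun[OF fda finite_dim_blinfun[OF fda fdHom]]

lemma tri\<pi>: "trilinear \<pi>" and tri\<mu>: "trilinear \<mu>"
  using \<pi> \<mu> by (auto simp: three_lie_algebra_def alternating3_def trilinear_def)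

lemma bracket_simps:
  "\<pi> (x + y) u v = \<pi> x u v + \<pi> y u v" "\<pi> u (x + y) v = \<pi> u x v + \<pi> u y v"
  "\<pi> u v (x + y) = \<pi> u v x + \<pi> u v y"
  "\<pi> (c *\<^sub>R x) u v = c *\<^sub>R \<pi> x u v" "\<pi> u (c *\<^sub>R x) v = c *\<^sub>R \<pi> u x v"
  "\<pi> u v (c *\<^sub>R x) = c *\<^sub>R \<pi> u v x"
  "\<mu> (x' + y') u' v' = \<mu> x' u' v' + \<mu> y' u' v'" "\<mu> u' (x' + y') v' = \<mu> u' x' v' + \<mu> u' y' v'"
  "\<mu> u' v' (x' + y') = \<mu> u' v' x' + \<mu> u' v' y'"
  "\<mu> (c *\<^sub>R x') u' v' = c *\<^sub>R \<mu> x' u' v'" "\<mu> u' (c *\<^sub>R x') v' = c *\<^sub>R \<mu> u' x' v'"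
  "\<mu> u' v' (c *\<^sub>R x') = c *\<^sub>R \<mu> u' v' x'"
  "\<mu> (x' - y') u' v' = \<mu> x' u' v' - \<mu> y' u' v'" "\<mu> u' (x' - y') v' = \<mu> u' x' v' - \<mu> u' y' v'"
  "\<mu> u' v' (x' - y') = \<mu> u' v' x' - \<mu> u' v' y'"
  using tri\<pi> tri\<mu> linear_diff[of "\<lambda>x. \<mu> x u' v'"] linear_diff[of "\<lambda>x. \<mu> u' x v'"]
  by (auto simp: trilinear_def linear_iff linear_diff)

section \<open>The defect of a linear map, its coboundary and its expansion at
  \<open>f\<close>\<close>

definition defect :: "('a \<Rightarrow>\<^sub>L 'b) \<Rightarrow> 'a \<Rightarrow> 'a \<Rightarrow> 'a \<Rightarrow> 'b" where
  "defect g x y z = \<mu> (g x) (g y) (g z) - g (\<pi> x y z)"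

lemma trilinear_defect: "trilinear (defect g)"
  unfolding trilinear_def defect_def
  by (intro conjI allI linearI) (simp_all add: bracket_simps blinfun.bilinear_simps algebra_simps)

lemma alternating3_defect: "alternating3 (defect g)"
  using \<pi> \<mu> trilinear_defect[of g] unfolding three_lie_algebra_def alternating3_def trilinear_def
  by (auto simp: defect_def blinfun.zero_right)

text \<open>The analogue of the Bianchi identity.\<close>

lemma coboundary2_defect: "coboundary2 \<pi> \<mu> g (defect g) x1 y1 x2 y2 x = 0"
proof -
  \<comment> \<open>The terms mixing \<mu> with g of a bracket cancel in pairs; the remaining ones
    cancel by the fundamental identities of \<pi> and of \<mu> at the images under g.\<close>
  have "\<pi> x1 y1 (\<pi> x2 y2 x) = \<pi> (\<pi> x1 y1 x2) y2 x + \<pi> x2 (\<pi> x1 y1 y2) x + \<pi> x2 y2 (\<pi> x1 y1 x)"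
    using \<pi> unfolding three_lie_algebra_def by blast
  moreover have "\<mu> (g x1) (g y1) (\<mu> (g x2) (g y2) (g x)) = \<mu> (\<mu> (g x1) (g y1) (g x2)) (g y2) (g x)
      + \<mu> (g x2) (\<mu> (g x1) (g y1) (g y2)) (g x) + \<mu> (g x2) (g y2) (\<mu> (g x1) (g y1) (g x))"
    using \<mu> unfolding three_lie_algebra_def by blast
  ultimately show ?thesis
    unfolding coboundary2_def defect_def by (simp add: bracket_simps blinfun.bilinear_simps)
qed

lemma trilinear_coboundary1: "trilinear (coboundary1 \<pi> \<mu> f \<eta>)"
  unfolding trilinear_def coboundary1_def
  by (intro conjI allI linearI) (simp_all add: bracket_simps blinfun.bilinear_simps algebra_simps)

definition \<Delta> :: "('a \<Rightarrow>\<^sub>L 'b) \<Rightarrow> 'a \<Rightarrow>\<^sub>L 'a \<Rightarrow>\<^sub>L 'a \<Rightarrow>\<^sub>L 'b" where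
  "\<Delta> \<eta> = blinfun3 (coboundary1 \<pi> \<mu> f \<eta>)"

definition \<Phi> :: "('a \<Rightarrow>\<^sub>L 'b) \<Rightarrow> 'a \<Rightarrow>\<^sub>L 'a \<Rightarrow>\<^sub>L 'a \<Rightarrow>\<^sub>L 'b" where
  "\<Phi> g = blinfun3 (defect g)"

text \<open>The cubic part of \<Phi> with its three slots kept apart, so that it can be expanded
  about \<open>f\<close>; the map \<open>K\<close> below is the linear part.\<close>

definition M :: "('a \<Rightarrow>\<^sub>L 'b) \<Rightarrow> ('a \<Rightarrow>\<^sub>L 'b) \<Rightarrow> ('a \<Rightarrow>\<^sub>L 'b) \<Rightarrow> 'a \<Rightarrow>\<^sub>L 'a \<Rightarrow>\<^sub>L 'a \<Rightarrow>\<^sub>L 'b" where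
  "M u v w = blinfun3 (\<lambda>x y z. \<mu> (u x) (v y) (w z))"

definition K :: "('a \<Rightarrow>\<^sub>L 'b) \<Rightarrow> 'a \<Rightarrow>\<^sub>L 'a \<Rightarrow>\<^sub>L 'a \<Rightarrow>\<^sub>L 'b" where
  "K u = blinfun3 (\<lambda>x y z. u (\<pi> x y z))"

lemma apply3_simps [simp]:
  "apply3 (\<Delta> \<eta>) x y z = coboundary1 \<pi> \<mu> f \<eta> x y z"
  "apply3 (\<Phi> g) x y z = defect g x y z"
  "apply3 (M u v w) x y z = \<mu> (u x) (v y) (w z)"
  "apply3 (K u) x y z = u (\<pi> x y z)"
proof -
  have "trilinear (\<lambda>x y z. \<mu> (u x) (v y) (w z))" "trilinear (\<lambda>x y z. u (\<pi> x y z))"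
    unfolding trilinear_def
    by (intro conjI allI linearI; simp add: bracket_simps blinfun.bilinear_simps)+
  then show "apply3 (\<Delta> \<eta>) x y z = coboundary1 \<pi> \<mu> f \<eta> x y z"
    "apply3 (\<Phi> g) x y z = defect g x y z" "apply3 (M u v w) x y z = \<mu> (u x) (v y) (w z)"
    "apply3 (K u) x y z = u (\<pi> x y z)"
    unfolding \<Delta>_def \<Phi>_def M_def K_def
    by (simp_all add: apply3_blinfun3[OF fda] trilinear_coboundary1 trilinear_defect)
qed

lemma linear_\<Delta>: "linear \<Delta>"
  by (rule linearI; rule blinfun3_eqI)
    (simp_all add: coboundary1_def bracket_simps blinfun.bilinear_simps algebra_simps)

lemma Z1_iff: "\<eta> \<in> Z1 \<pi> \<mu> f \<longleftrightarrow> \<Delta> \<eta> = 0"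
proof -
  have "\<Delta> \<eta> = 0 \<longleftrightarrow> (\<forall>x y z. coboundary1 \<pi> \<mu> f \<eta> x y z = 0)"
    by (metis apply3_simps(1) blinfun.zero_left blinfun3_eqI)
  then show ?thesis by (simp add: Z1_def)
qed

lemma subspace_Z1: "subspace (Z1 \<pi> \<mu> f)"
proof -
  have "Z1 \<pi> \<mu> f = {\<eta>. \<Delta> \<eta> = 0}" using Z1_iff by blast
  then show ?thesis using linear_subspace_kernel[OF linear_\<Delta>] by simp
qed

lemma morphism_iff: "three_lie_morphism \<pi> \<mu> g \<longleftrightarrow> \<Phi> g = 0"
proof -
  have "\<Phi> g = 0 \<longleftrightarrow> (\<forall>x y z. defect g x y z = 0)"
    by (metis apply3_simps(2) blinfun.zero_left blinfun3_eqI)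
  then show ?thesis by (auto simp: three_lie_morphism_def defect_def)
qed

lemma linear_M: "linear (\<lambda>u. M u v w)" "linear (\<lambda>v. M u v w)" "linear (\<lambda>w. M u v w)"
  and linear_K: "linear K"
  by ((rule linearI; rule blinfun3_eqI); simp add: bracket_simps blinfun.bilinear_simps)+

lemma \<Phi>_eq: "\<Phi> g = M g g g - K g"
  by (rule blinfun3_eqI) (simp add: defect_def blinfun.bilinear_simps)

text \<open>The cubic term is the diagonal of a trilinear map: the last two slots are identified
  first, then the first one.\<close>

lemma polynomial_function_\<Phi>: "polynomial_function \<Phi>"
proof -
  note lin = polynomial_function_bounded_linear[OF finite_dim_linear_bounded[OF fdHom]]
  have "polynomial_function (\<lambda>g. M u g g)" for u
    by (rule polynomial_function_diagonal[OF fdHom, where G = "M u"]) (intro linear_M lin)+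
  then have "polynomial_function (\<lambda>g. M g g g)"
    by (intro polynomial_function_diagonal[OF fdHom, where G = "\<lambda>u g. M u g g"] linear_M)
  moreover have "polynomial_function K" by (intro lin linear_K)
  ultimately have "polynomial_function (\<lambda>g. M g g g - K g)" by (rule polynomial_function_diff)
  then show ?thesis by (simp add: \<Phi>_eq[abs_def])
qed

text \<open>The constant term vanishes because \<open>f\<close> is a morphism. The linear
  coefficient identifies \<Delta> as the derivative of \<Phi> at \<open>f\<close>.\<close>

lemma \<Phi>_expand:
  "\<Phi> (f + t *\<^sub>R \<eta>) = t *\<^sub>R \<Delta> \<eta> + t^2 *\<^sub>R (M \<eta> \<eta> f + M \<eta> f \<eta> + M f \<eta> \<eta>) + t^3 *\<^sub>R M \<eta> \<eta> \<eta>"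
proof (rule blinfun3_eqI)
  fix x y z
  have "f (\<pi> x y z) = \<mu> (f x) (f y) (f z)" using f by (simp add: three_lie_morphism_def)
  then show "apply3 (\<Phi> (f + t *\<^sub>R \<eta>)) x y z = apply3 (t *\<^sub>R \<Delta> \<eta> +
      t^2 *\<^sub>R (M \<eta> \<eta> f + M \<eta> f \<eta> + M f \<eta> \<eta>) + t^3 *\<^sub>R M \<eta> \<eta> \<eta>) x y z"
    by (simp add: blinfun.add_left blinfun.scaleR_left defect_def coboundary1_def bracket_simps
        scaleR_add_right scaleR_diff_right power2_eq_square power3_eq_cube mult.assoc)
qed

section \<open>Limits of cocycle conditions and vanishing of nearby cocycles\<close>

lemma tendsto_\<mu>:
  assumes "(X \<longlongrightarrow> x) F" "(Y \<longlongrightarrow> y) F" "(Z \<longlongrightarrow> z) F"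
  shows "((\<lambda>n. \<mu> (X n) (Y n) (Z n)) \<longlongrightarrow> \<mu> x y z) F"
proof -
  \<comment> \<open>Writing \<mu> as an iterated operator makes its continuity a matter of the limit
    rules for operator application.\<close>
  have "\<mu> x y z = apply3 (blinfun3 \<mu>) x y z" for x y z by (simp add: apply3_blinfun3[OF fdb tri\<mu>])
  then show ?thesis using assms by (simp only:) (intro tendsto_intros)
qed

lemma tendsto_coboundary2:
  assumes "(g \<longlongrightarrow> g') F" "(\<theta> \<longlongrightarrow> \<theta>') F"
  shows "((\<lambda>n. coboundary2 \<pi> \<mu> (g n) (apply3 (\<theta> n)) x1 y1 x2 y2 x) \<longlongrightarrow>
    coboundary2 \<pi> \<mu> g' (apply3 \<theta>') x1 y1 x2 y2 x) F"
  unfolding coboundary2_def by (intro tendsto_intros tendsto_\<mu> assms)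

lemma coboundary2_scaleR:
  "coboundary2 \<pi> \<mu> g (apply3 (c *\<^sub>R \<theta>)) x1 y1 x2 y2 x = c *\<^sub>R coboundary2 \<pi> \<mu> g (apply3 \<theta>) x1 y1 x2 y2 x"
  unfolding coboundary2_def
  by (simp add: blinfun.scaleR_left bracket_simps scaleR_add_right scaleR_diff_right)

lemma alternating3_apply3:
  "alternating3 (apply3 \<theta>) \<longleftrightarrow> (\<forall>x y. apply3 \<theta> x x y = 0 \<and> apply3 \<theta> x y x = 0 \<and> apply3 \<theta> y x x = 0)"
proof -
  have "linear (\<lambda>x. apply3 \<theta> x y z)" "linear (\<lambda>y. apply3 \<theta> x y z)" "linear (\<lambda>z. apply3 \<theta> x y z)" for x y z
    by (intro linearI; simp add: blinfun.bilinear_simps)+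
  then show ?thesis by (simp add: alternating3_def)
qed

end

text \<open>Compactness: normalized counterexamples with g tending to \<open>f\<close> subconverge
  to a unit cochain l that is a cocycle for \<open>f\<close> with \<open>\<Delta> (T l) = 0\<close>.
  As l is a coboundary \<open>\<Delta> \<eta>\<close>, it equals \<open>\<Delta> (T l)\<close> and
  vanishes, a contradiction.\<close>

lemma (in finite_dim_three_lie_morphism) nearby_cocycle_eq_0:
  assumes Z2: "Z2 \<pi> \<mu> f \<subseteq> B2 \<pi> \<mu> f" and T: "linear T" "\<And>\<eta>. \<Delta> (T (\<Delta> \<eta>)) = \<Delta> \<eta>"
  shows "\<exists>\<epsilon>>0. \<forall>g \<theta>. dist g f < \<epsilon> \<longrightarrow> alternating3 (apply3 \<theta>) \<longrightarrow> \<Delta> (T \<theta>) = 0 \<longrightarrow>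
    (\<forall>x1 y1 x2 y2 x. coboundary2 \<pi> \<mu> g (apply3 \<theta>) x1 y1 x2 y2 x = 0) \<longrightarrow> \<theta> = 0"
proof (rule ccontr)
  define P where "P = (\<lambda>g \<theta>. alternating3 (apply3 \<theta>) \<and> \<Delta> (T \<theta>) = 0 \<and>
    (\<forall>x1 y1 x2 y2 x. coboundary2 \<pi> \<mu> g (apply3 \<theta>) x1 y1 x2 y2 x = 0))"
  assume "\<not> ?thesis"
  then have neg: "\<exists>g \<theta>. dist g f < \<epsilon> \<and> P g \<theta> \<and> \<theta> \<noteq> 0" if "\<epsilon> > 0" for \<epsilon>
    using that unfolding P_def by blast
  have linT: "linear (\<lambda>\<theta>. \<Delta> (T \<theta>))" using linear_compose[OF T(1) linear_\<Delta>] by (simp add: o_def)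
  \<comment> \<open>All conditions in P are homogeneous in \<theta>, so a nonzero counterexample can
    be scaled to norm 1.\<close>
  have "\<exists>g \<theta>. dist g f < \<epsilon> \<and> P g \<theta> \<and> norm \<theta> = 1" if \<epsilon>: "\<epsilon> > 0" for \<epsilon>
  proof -
    obtain g \<theta> where g: "dist g f < \<epsilon>" "P g \<theta>" "\<theta> \<noteq> 0" using neg[OF \<epsilon>] by blast
    have "P g ((1 / norm \<theta>) *\<^sub>R \<theta>)"
      using g(2) unfolding P_def alternating3_apply3 coboundary2_scaleR linear_scale[OF linT]
      by (simp add: blinfun.scaleR_left)
    moreover have "norm ((1 / norm \<theta>) *\<^sub>R \<theta>) = 1" using g(3) by simp
    ultimately show ?thesis using g(1) by blast
  qed
  then have "\<forall>n. \<exists>g \<theta>. dist g f < 1 / real (Suc n) \<and> P g \<theta> \<and> norm \<theta> = 1" by simp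
  then obtain g \<theta> where g: "\<And>n. dist (g n) f < 1 / real (Suc n)" and \<theta>: "\<And>n. P (g n) (\<theta> n)"
    "\<And>n. norm (\<theta> n) = 1"
    by metis
  have "g \<longlonglongrightarrow> f"
    by (rule metric_tendsto_imp_tendsto[OF LIMSEQ_inverse_real_of_nat])
      (use g in \<open>auto simp: inverse_eq_divide intro!: always_eventually less_imp_le\<close>)
  have "seq_compact (cball (0 :: 'a \<Rightarrow>\<^sub>L 'a \<Rightarrow>\<^sub>L 'a \<Rightarrow>\<^sub>L 'b) 1)"
    using compact_cball_finite_dim[OF fdC2] by (simp add: compact_eq_seq_compact_metric)
  moreover have "\<forall>n. \<theta> n \<in> cball 0 1" using \<theta>(2) by simp
  ultimately obtain l r where r: "strict_mono r" and l: "(\<theta> \<circ> r) \<longlonglongrightarrow> l"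
    by (metis seq_compactE)
  have gr: "(\<lambda>n. g (r n)) \<longlonglongrightarrow> f"
    using LIMSEQ_subseq_LIMSEQ[OF \<open>g \<longlonglongrightarrow> f\<close> r] by (simp add: o_def)
  have l': "(\<lambda>n. \<theta> (r n)) \<longlonglongrightarrow> l" using l by (simp add: o_def)
  have "(\<lambda>n. norm (\<theta> (r n))) \<longlonglongrightarrow> norm l" using l' by (rule tendsto_norm)
  then have norm: "norm l = 1" using \<theta>(2) LIMSEQ_unique by (simp add: LIMSEQ_const_iff)
  \<comment> \<open>Each condition in P is an equation with 0 whose left side converges along the
    subsequence, so it passes to the limit.\<close>
  have zero: "L = 0" if "(\<lambda>n. X (r n)) \<longlonglongrightarrow> L" "\<And>n. X n = 0"
    for X :: "nat \<Rightarrow> 'z::real_normed_vector" and L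
    using that by (simp add: LIMSEQ_const_iff)
  have "bounded_linear (\<lambda>\<theta>. \<Delta> (T \<theta>))" by (rule finite_dim_linear_bounded[OF fdC2 linT])
  from zero[OF bounded_linear.tendsto[OF this l']] have Tl: "\<Delta> (T l) = 0" using \<theta>(1) P_def by blast
  have "coboundary2 \<pi> \<mu> f (apply3 l) x1 y1 x2 y2 x = 0" for x1 y1 x2 y2 x
    by (rule zero[OF tendsto_coboundary2[OF gr l', of x1 y1 x2 y2 x]]) (use \<theta>(1) P_def in blast)
  moreover have "alternating3 (apply3 l)"
  proof -
    have lim: "(\<lambda>n. apply3 (\<theta> (r n)) x y z) \<longlonglongrightarrow> apply3 l x y z" for x y z
      by (intro tendsto_intros l')
    have "apply3 (\<theta> n) x x y = 0 \<and> apply3 (\<theta> n) x y x = 0 \<and> apply3 (\<theta> n) y x x = 0" for n x y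
      using \<theta>(1)[of n] unfolding P_def alternating3_apply3 by blast
    moreover have "apply3 l x y z = 0" if "\<And>n. apply3 (\<theta> n) x y z = 0" for x y z
      using lim[of x y z] that by (simp add: LIMSEQ_const_iff)
    ultimately show ?thesis unfolding alternating3_apply3 by blast
  qed
  ultimately have "apply3 l \<in> Z2 \<pi> \<mu> f" by (simp add: Z2_def)
  then obtain \<eta> where "apply3 l = coboundary1 \<pi> \<mu> f \<eta>" using Z2 by (auto simp: B2_def)
  then have "l = \<Delta> \<eta>" by (intro blinfun3_eqI) (simp add: fun_eq_iff)
  then show False using T(2)[of \<eta>] Tl norm by simp
qed

text \<open>The relation is reflexive at \<theta> since the coboundary of 0 is 0, so \<theta> lies
  in its own coset; the only coset is \<open>B2 \<pi> \<mu> f\<close>.\<close>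

lemma Z2_subset_B2:
  assumes "H2 \<pi> \<mu> f = {B2 \<pi> \<mu> f}" and \<mu>: "alternating3 \<mu>"
  shows "Z2 \<pi> \<mu> f \<subseteq> B2 \<pi> \<mu> f"
proof
  fix \<theta> assume \<theta>: "\<theta> \<in> Z2 \<pi> \<mu> f"
  have "\<mu> 0 y z = 0 \<and> \<mu> y 0 z = 0 \<and> \<mu> y z 0 = 0" for y z
    using \<mu> unfolding alternating3_def by (metis linear_0)
  then have "coboundary1 \<pi> \<mu> f 0 = (\<lambda>x y z. \<theta> x y z - \<theta> x y z)"
    by (simp add: coboundary1_def fun_eq_iff)
  then have "(\<lambda>x y z. \<theta> x y z - \<theta> x y z) \<in> B2 \<pi> \<mu> f" unfolding B2_def by (metis rangeI)
  moreover define R where "R = {(\<theta>, \<theta>'). \<theta> \<in> Z2 \<pi> \<mu> f \<and> \<theta>' \<in> Z2 \<pi> \<mu> f \<and>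
    (\<lambda>x y z. \<theta>' x y z - \<theta> x y z) \<in> B2 \<pi> \<mu> f}"
  ultimately have "\<theta> \<in> R `` {\<theta>}" using \<theta> by simp
  moreover have "R `` {\<theta>} \<in> H2 \<pi> \<mu> f" unfolding H2_def R_def using \<theta> by (rule quotientI)
  ultimately show "\<theta> \<in> B2 \<pi> \<mu> f" unfolding assms(1) by blast
qed

text \<open>A single chart centred at \<open>f\<close> straightens all morphisms in U into
  \<open>Z1 \<pi> \<mu> f\<close>; normalizing the derivative of \<psi> at 0 to the identity gives
  deformations their prescribed velocity.\<close>

lemma (in finite_dim_three_lie_morphism) morphism_chart:
  assumes "Z2 \<pi> \<mu> f \<subseteq> B2 \<pi> \<mu> f"
  shows "\<exists>U V \<phi> \<psi>. f \<in> U \<and> diffeomorphism U V \<phi> \<psi> \<and> \<phi> f = 0 \<and>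
    (\<psi> has_derivative (\<lambda>v. v)) (at 0) \<and>
    (\<forall>g\<in>U. three_lie_morphism \<pi> \<mu> g \<longleftrightarrow> \<phi> g \<in> Z1 \<pi> \<mu> f)"
proof -
  \<comment> \<open>T is a linear right inverse of \<Delta> on its range, whence \<Delta> T \<Delta>
    = \<Delta>.\<close>
  obtain T where T1: "linear T" and "\<forall>\<theta>\<in>\<Delta> ` UNIV. \<Delta> (T \<theta>) = \<theta>"
    using real_vector.linear_exists_right_inverse_on[OF linear_\<Delta> subspace_UNIV] by blast
  then have T2: "\<Delta> (T (\<Delta> \<eta>)) = \<Delta> \<eta>" for \<eta> by blast
  obtain \<epsilon> where \<epsilon>: "\<epsilon> > 0" "\<forall>g \<theta>. dist g f < \<epsilon> \<longrightarrow> alternating3 (apply3 \<theta>) \<longrightarrow> \<Delta> (T \<theta>) = 0 \<longrightarrow>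
    (\<forall>x1 y1 x2 y2 x. coboundary2 \<pi> \<mu> g (apply3 \<theta>) x1 y1 x2 y2 x = 0) \<longrightarrow> \<theta> = 0"
    using nearby_cocycle_eq_0[OF assms T1 T2] by (elim exE conjE)
  define \<phi> where "\<phi> = (\<lambda>g. (g - f) - T (\<Delta> (g - f)) + T (\<Phi> g))"
  have bT: "bounded_linear T" by (rule finite_dim_linear_bounded[OF fdC2 T1])
  have b\<Delta>: "bounded_linear \<Delta>" by (rule finite_dim_linear_bounded[OF fdHom linear_\<Delta>])
  have pol: "polynomial_function \<phi>"
    unfolding \<phi>_def
    by (intro polynomial_function_add polynomial_function_diff polynomial_function_id
        polynomial_function_const polynomial_function_\<Phi>
        polynomial_function_compose_bounded_linear[OF bT] polynomial_function_compose_bounded_linear[OF b\<Delta>])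
  \<comment> \<open>The first two summands of \<phi> together lie in the kernel of \<Delta>.\<close>
  have \<Delta>\<phi>: "\<Delta> (\<phi> g) = \<Delta> (T (\<Phi> g))" for g
    using linear_add[OF linear_\<Delta>, of "(g - f) - T (\<Delta> (g - f))" "T (\<Phi> g)"]
      linear_diff[OF linear_\<Delta>, of "g - f" "T (\<Delta> (g - f))"]
    by (simp only: \<phi>_def T2 diff_self add_0)
  have \<phi>f: "\<phi> f = 0"
    using f by (simp add: \<phi>_def morphism_iff linear_0[OF linear_\<Delta>] linear_0[OF T1])
  have "(\<phi> has_derivative (\<lambda>v. v)) (at f)"
  proof -
    \<comment> \<open>The derivative exists because \<phi> is polynomial, so it can be computed
      along lines.\<close>
    obtain D where D: "\<forall>x. (\<phi> has_derivative D x) (at x)"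
      using polynomial_function_has_derivative[OF fdHom pol] by (elim exE conjE)
    have "D f \<eta> = \<eta>" for \<eta>
    proof -
      \<comment> \<open>Along the line through \<open>f\<close> the linear term of
        \<open>T (\<Phi> g)\<close> cancels \<open>- T (\<Delta> (g - f))\<close>, leaving
        \<open>t *\<^sub>R \<eta>\<close>; Q and R are the quadratic and cubic coefficients, without
        first-order contribution at 0.\<close>
      define Q where "Q = T (M \<eta> \<eta> f + M \<eta> f \<eta> + M f \<eta> \<eta>)"
      define R where "R = T (M \<eta> \<eta> \<eta>)"
      have "\<phi> (f + t *\<^sub>R \<eta>) = t *\<^sub>R \<eta> + t^2 *\<^sub>R Q + t^3 *\<^sub>R R" for t
        unfolding \<phi>_def \<Phi>_expand Q_def R_def
        by (simp add: linear_add[OF T1] linear_scale[OF T1] linear_scale[OF linear_\<Delta>])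
      moreover have "((\<lambda>t::real. t *\<^sub>R \<eta> + t^2 *\<^sub>R Q + t^3 *\<^sub>R R) has_derivative
          (\<lambda>s. s *\<^sub>R \<eta> + (of_nat 2 * s * 0 ^ (2 - 1)) *\<^sub>R Q + (of_nat 3 * s * 0 ^ (3 - 1)) *\<^sub>R R)) (at 0)"
        by (intro has_derivative_add has_derivative_scaleR_left has_derivative_power has_derivative_ident)
      ultimately have 1: "((\<lambda>t. \<phi> (f + t *\<^sub>R \<eta>)) has_derivative (\<lambda>s. s *\<^sub>R \<eta>)) (at 0)" by simp
      have "((\<lambda>t::real. f + t *\<^sub>R \<eta>) has_derivative (\<lambda>s. s *\<^sub>R \<eta>)) (at 0)"
        by (auto intro!: derivative_eq_intros)
      moreover have "(\<phi> has_derivative D f) (at (f + 0 *\<^sub>R \<eta>))" using D by simp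
      ultimately have "((\<lambda>t. \<phi> (f + t *\<^sub>R \<eta>)) has_derivative (\<lambda>s. D f (s *\<^sub>R \<eta>))) (at 0)"
        by (rule has_derivative_compose)
      from has_derivative_unique[OF this 1] have "D f (1 *\<^sub>R \<eta>) = 1 *\<^sub>R \<eta>" by (rule fun_cong)
      then show ?thesis by simp
    qed
    then have "D f = (\<lambda>v. v)" by blast
    then show ?thesis using D by metis
  qed
  \<comment> \<open>Taking U inside the ball of radius \<epsilon> makes the vanishing of nearby
    cocycles available for every g in U.\<close>
  then obtain U V \<psi> where U: "f \<in> U" "U \<subseteq> ball f \<epsilon>" "diffeomorphism U V \<phi> \<psi>"
    "(\<psi> has_derivative (\<lambda>v. v)) (at (\<phi> f))"
    using polynomial_local_diffeomorphism[OF fdHom pol _ open_ball, of f f \<epsilon>] \<epsilon>(1) by auto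
  have "three_lie_morphism \<pi> \<mu> g \<longleftrightarrow> \<phi> g \<in> Z1 \<pi> \<mu> f" if g: "g \<in> U" for g
  proof
    assume "three_lie_morphism \<pi> \<mu> g"
    then show "\<phi> g \<in> Z1 \<pi> \<mu> f"
      by (simp add: Z1_iff \<Delta>\<phi> morphism_iff linear_0[OF linear_\<Delta>] linear_0[OF T1])
  next
    assume "\<phi> g \<in> Z1 \<pi> \<mu> f"
    then have "\<Delta> (T (\<Phi> g)) = 0" by (simp add: Z1_iff \<Delta>\<phi>)
    moreover have \<Phi>: "apply3 (\<Phi> g) = defect g" by (simp add: fun_eq_iff)
    have "alternating3 (apply3 (\<Phi> g))" unfolding \<Phi> by (rule alternating3_defect)
    moreover have "\<forall>x1 y1 x2 y2 x. coboundary2 \<pi> \<mu> g (apply3 (\<Phi> g)) x1 y1 x2 y2 x = 0"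
      unfolding \<Phi> by (intro allI coboundary2_defect)
    moreover have "dist g f < \<epsilon>" using g U(2) by (auto simp: dist_commute)
    ultimately have "\<Phi> g = 0" using \<epsilon>(2) by blast
    then show "three_lie_morphism \<pi> \<mu> g" by (simp add: morphism_iff)
  qed
  with U \<phi>f show ?thesis
    by (intro exI[of _ U] exI[of _ V] exI[of _ \<phi>] exI[of _ \<psi>]) simp
qed

section \<open>The submanifold of morphisms and the deformations\<close>

theorem theorem4p9:
  fixes \<pi> :: "'a::real_normed_vector \<Rightarrow> 'a \<Rightarrow> 'a \<Rightarrow> 'a"
    and \<mu> :: "'b::real_normed_vector \<Rightarrow> 'b \<Rightarrow> 'b \<Rightarrow> 'b"
    and f :: "'a \<Rightarrow>\<^sub>L 'b"
  assumes "\<exists>B :: 'a set. finite B \<and> span B = UNIV"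
    and "\<exists>B :: 'b set. finite B \<and> span B = UNIV"
    and "three_lie_algebra \<pi>"
    and "three_lie_algebra \<mu>"
    and "three_lie_morphism \<pi> \<mu> f"
    and "H2 \<pi> \<mu> f = {B2 \<pi> \<mu> f}"
  shows "(\<exists>W. open W \<and> f \<in> W \<and>
            smooth_submanifold ({g. three_lie_morphism \<pi> \<mu> g} \<inter> W) (dim (Z1 \<pi> \<mu> f))) \<and>
         (\<forall>\<alpha>\<in>Z1 \<pi> \<mu> f. \<exists>I F. deformation \<pi> \<mu> f I F \<and> (F has_vector_derivative \<alpha>) (at 0))"
proof -
  interpret finite_dim_three_lie_morphism \<pi> \<mu> f
    using assms by unfold_locales (auto simp: finite_dim_def)
  have "Z2 \<pi> \<mu> f \<subseteq> B2 \<pi> \<mu> f"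
    using Z2_subset_B2[OF assms(6)] assms(4) by (simp add: three_lie_algebra_def)
  from morphism_chart[OF this] obtain U V \<phi> \<psi> where U: "f \<in> U" "diffeomorphism U V \<phi> \<psi>" "\<phi> f = 0"
    "(\<psi> has_derivative (\<lambda>v. v)) (at 0)"
    and chart: "\<forall>g\<in>U. three_lie_morphism \<pi> \<mu> g \<longleftrightarrow> \<phi> g \<in> Z1 \<pi> \<mu> f"
    by (elim exE conjE)
  have \<psi>: "\<psi> y \<in> U" "\<phi> (\<psi> y) = y" if "y \<in> V" for y
    using U(2) that by (auto simp: diffeomorphism_def homeomorphism_def)
  have \<phi>: "\<phi> g \<in> V" "\<psi> (\<phi> g) = g" if "g \<in> U" for g
    using U(2) that by (auto simp: diffeomorphism_def homeomorphism_def)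
  have opens: "open U" "open V" using U(2) by (auto simp: diffeomorphism_def)
  \<comment> \<open>One U is the neighbourhood of \<open>f\<close>, the other the chart domain; the
    same chart serves at every morphism in U.\<close>
  have image: "\<phi> ` ({g. three_lie_morphism \<pi> \<mu> g} \<inter> U \<inter> U) = Z1 \<pi> \<mu> f \<inter> V"
  proof (intro equalityI subsetI)
    fix y assume y: "y \<in> Z1 \<pi> \<mu> f \<inter> V"
    then have "\<psi> y \<in> {g. three_lie_morphism \<pi> \<mu> g} \<inter> U \<inter> U" using chart \<psi> by auto
    then show "y \<in> \<phi> ` ({g. three_lie_morphism \<pi> \<mu> g} \<inter> U \<inter> U)"
      using \<psi>(2)[of y] y by (metis IntD2 imageI)
  qed (use chart \<phi> in auto)
  have "smooth_submanifold ({g. three_lie_morphism \<pi> \<mu> g} \<inter> U) (dim (Z1 \<pi> \<mu> f))"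
    unfolding smooth_submanifold_def
  proof
    fix p assume "p \<in> {g. three_lie_morphism \<pi> \<mu> g} \<inter> U"
    then have "p \<in> U" by simp
    show "\<exists>U' V \<phi> \<psi> L. p \<in> U' \<and> diffeomorphism U' V \<phi> \<psi> \<and> subspace L \<and> dim (L :: ('a \<Rightarrow>\<^sub>L 'b) set) = dim (Z1 \<pi> \<mu> f) \<and>
        \<phi> ` ({g. three_lie_morphism \<pi> \<mu> g} \<inter> U \<inter> U') = L \<inter> V"
      by (intro exI conjI) (rule \<open>p \<in> U\<close> U(2) subspace_Z1 refl image)+
  qed
  moreover have "\<exists>I F. deformation \<pi> \<mu> f I F \<and> (F has_vector_derivative \<alpha>) (at 0)"
    if \<alpha>: "\<alpha> \<in> Z1 \<pi> \<mu> f" for \<alpha>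
  proof -
    have lin: "bounded_linear (\<lambda>t::real. t *\<^sub>R \<alpha>)" by (rule bounded_linear_scaleR_left)
    have "open ((\<lambda>t::real. t *\<^sub>R \<alpha>) -` V)"
      by (intro open_vimage opens linear_continuous_on lin)
    moreover have "0 \<in> (\<lambda>t::real. t *\<^sub>R \<alpha>) -` V" using \<phi>(1)[OF U(1)] U(3) by simp
    ultimately obtain e where e: "e > 0" "ball 0 e \<subseteq> (\<lambda>t::real. t *\<^sub>R \<alpha>) -` V"
      by (meson open_contains_ball)
    have V: "t *\<^sub>R \<alpha> \<in> V" if "t \<in> ball 0 e" for t using e(2) that by blast
    \<comment> \<open>The curve is the line spanned by \<alpha> seen through the chart. The line
      stays in \<open>Z1 \<pi> \<mu> f\<close>, so the curve consists of morphisms, and its velocity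
      at 0 is \<alpha> because \<psi> has identity derivative there.\<close>
    define F where "F = (\<lambda>t. \<psi> (t *\<^sub>R \<alpha>))"
    have "smooth_on V \<psi>" using U(2) by (simp add: diffeomorphism_def)
    then have "smooth_on (ball 0 e) F"
      unfolding smooth_on_def F_def
      by (intro allI Ck_on_compose_bounded_linear[OF lin open_ball, of 0 e V]) (use V in auto)
    moreover have "three_lie_morphism \<pi> \<mu> (F t)" if "t \<in> ball 0 e" for t
      unfolding F_def using chart[rule_format, OF \<psi>(1)[OF V[OF that]]] \<psi>(2)[OF V[OF that]] subspace_scale[OF subspace_Z1 \<alpha>]
      by simp
    moreover have "F 0 = f" using \<phi>(2)[OF U(1)] U(3) by (simp add: F_def)
    moreover have "is_interval (ball (0::real) e)" by (simp add: is_interval_convex_1)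
    ultimately have "deformation \<pi> \<mu> f (ball 0 e) F" using e(1) by (simp add: deformation_def)
    moreover have "(F has_vector_derivative \<alpha>) (at 0)"
    proof -
      have "((\<lambda>t::real. t *\<^sub>R \<alpha>) has_derivative (\<lambda>t. t *\<^sub>R \<alpha>)) (at 0)"
        using lin by (rule bounded_linear_imp_has_derivative)
      moreover have "(\<psi> has_derivative (\<lambda>v. v)) (at (0 *\<^sub>R \<alpha>))" using U(4) by simp
      ultimately have "((\<lambda>t. \<psi> (t *\<^sub>R \<alpha>)) has_derivative (\<lambda>t. t *\<^sub>R \<alpha>)) (at 0)"
        by (rule has_derivative_compose)
      then show ?thesis by (simp add: has_vector_derivative_def F_def)
    qed
    ultimately show ?thesis by blast
  qed
  ultimately show ?thesis using opens(1) U(1) by blast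
qed

end
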